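(* Let $\textnormal{R}\in\{\textnormal{ML},\textnormal{wML},\textnormal{C},\textnormal{S},\textnormal{CH},\textnormal{wCH}\}$, let $\varphi$ be a computable precise temporal forecasting system, and let $\omega\in\Omega$ be a path that is $\textnormal{R}$-random for $\varphi$. Then $I_\textnormal{R}(\omega)=I_\varphi(\omega)$, where $I_\varphi(\omega)=\big[\liminf_{n\to\infty}\underline{\varphi}(\omega_{1:n}),\ \limsup_{n\to\infty}\overline{\varphi}(\omega_{1:n})\big]$.
   Context: $\mathcal{X}=\{0,1\}$; $\Omega=\mathcal{X}^{\mathbb{N}}$ (paths $\omega=(\omega_1,\omega_2,\dots)$); $\mathbb{S}=\bigcup_{n\geq0}\mathcal{X}^n$ (situations), $\square$ the empty string, $|s|$ length, $sx$ concatenation, $\omega_{1:n}=(\omega_1,\dots,\omega_n)$, $\omega_{1:0}=\square$. $\mathcal{I}$: nonempty closed intervals $I\subseteq[0,1]$. A forecasting system is a map $\varphi:\mathbb{S}\to\mathcal{I}$; $\underline{\varphi}=\min\varphi$, $\overline{\varphi}=\max\varphi$; precise if $\underline\varphi=\overline\varphi$; temporal if $\varphi(s)=\varphi(t)$ whenever $|s|=|t|$. An interval forecast $I$ is identified with the constant forecasting system $s\mapsto I$. A real map $r$ on a countable effectively encoded set $\mathcal D$ is computable if there is a recursive $q:\mathcal{D}\times\mathbb{N}_0\to\mathbb{Q}$ with $|r(d)-q(d,n)|<2^{-n}$; lower semicomputable if there is a recursive $q$ with $q(d,n+1)\ge q(d,n)$ and $r(d)=\lim_n q(d,n)$. $\varphi$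 is computable if $\underline\varphi,\overline\varphi$ are. $\overline{E}_I(f)=\max_{p\in I}[pf(1)+(1-p)f(0)]$ for $f:\mathcal X\to\mathbb R$. A real process $F:\mathbb S\to\mathbb R$ is a supermartingale for $\varphi$ if $\overline{E}_{\varphi(s)}(F(s\,\cdot)-F(s))\le0$ for all $s$; a test supermartingale if also $F\ge0$, $F(\square)=1$. A multiplier process $D$ maps situations to gambles and generates $D^{\circledcirc}(x_1,\dots,x_n)=\prod_{k=0}^{n-1}D(x_{1:k})(x_{k+1})$; $D$ is lower semicomputable if $(s,x)\mapsto D(s)(x)$ is. Randomness for a path $\omega$ and forecasting system $\varphi$: ML-random if no lower semicomputable test supermartingale $T$ for $\varphi$ has $\limsup_nT(\omega_{1:n})=\infty$; wML-random if no test supermartingale for $\varphi$ of the form $D^{\circledcirc}$, $D$ a lower semicomputable multiplier process, has this; C-random if no computable test supermartingale for $\varphi$ has this; S-random if there is no computable test supermartingale $T$ for $\varphi$ together with a computable non-decreasing unbounded $\tau:\mathbb N_0\to\mathbb R_{\ge0}$ such that $\limsup_n[T(\omega_{1:n})-\tau(n)]\ge0$. CH-random (resp. wCH-random) if for every recursive (resp. recursive and temporal, i.e. depending only on $|s|$) selection process $S:\mathbb S\to\{0,1\}$ with $\sum_{k=0}^{n-1}S(\omega_{1:k})\to\infty$: $\liminf_n \frac{\sum_{k<n}S(\omega_{1:k})[\omega_{k+1}-\underline\varphi(\omega_{1:k})]}{\sum_{k<n}S(\omega_{1:k})}\ge0$ and $\limsup_n \frac{\sum_{k<n}S(\omega_{1:k})[\omega_{k+1}-\overline\varphi(\omega_{1:k})]}{\sum_{k<n}S(\omega_{1:k})}\le0$.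 $\mathcal I_\textnormal{R}(\omega)=\{I\in\mathcal I:\omega\text{ is R-random for }I\}$, $I_\textnormal{R}(\omega)=\bigcap_{I\in\mathcal I_\textnormal{R}(\omega)}I$. *)

theory Defs
  imports "HOL-Analysis.Analysis" "HOL-Library.Nat_Bijection"
begin

datatype recf = Zero | Succ | Proj nat | Comp recf "recf list" | Prim recf recf | Mn recf

inductive eval_rf :: "recf \<Rightarrow> nat list \<Rightarrow> nat \<Rightarrow> bool" where
  ev_zero: "eval_rf Zero xs 0"
| ev_succ: "eval_rf Succ (x # xs) (Suc x)"
| ev_proj: "i < length xs \<Longrightarrow> eval_rf (Proj i) xs (xs ! i)"
| ev_comp: "length ys = length gs \<Longrightarrow> (\<forall>i < length gs. eval_rf (gs ! i) xs (ys ! i))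
            \<Longrightarrow> eval_rf f ys z \<Longrightarrow> eval_rf (Comp f gs) xs z"
| ev_prim0: "eval_rf f xs y \<Longrightarrow> eval_rf (Prim f g) (0 # xs) y"
| ev_primS: "eval_rf (Prim f g) (n # xs) y \<Longrightarrow> eval_rf g (n # y # xs) z
            \<Longrightarrow> eval_rf (Prim f g) (Suc n # xs) z"
| ev_mn: "eval_rf f (n # xs) 0 \<Longrightarrow> (\<forall>m < n. \<exists>y. eval_rf f (m # xs) (Suc y))
            \<Longrightarrow> eval_rf (Mn f) xs n"

definition recursive_fun :: "(nat \<Rightarrow> nat) \<Rightarrow> bool" where
  "recursive_fun g \<longleftrightarrow> (\<exists>f. \<forall>x. eval_rf f [x] (g x))"

text \<open>Binary alphabet X = {0,1} is rendered as bool (True = 1); situations are bool lists.\<close>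
definition sit_code :: "bool list \<Rightarrow> nat" where
  "sit_code s = list_encode (map of_bool s)"

definition sitx_code :: "bool list \<times> bool \<Rightarrow> nat" where
  "sitx_code sx = prod_encode (sit_code (fst sx), of_bool (snd sx))"

text \<open>Decoding natural numbers onto the rationals (surjective), as reals.\<close>
definition rat_dec :: "nat \<Rightarrow> real" where
  "rat_dec c = (case prod_decode c of (a, b) \<Rightarrow> real_of_int (int_decode a) / real (Suc b))"

definition rec_rat_map :: "('d \<Rightarrow> nat) \<Rightarrow> ('d \<Rightarrow> nat \<Rightarrow> real) \<Rightarrow> bool" where
  "rec_rat_map enc q \<longleftrightarrow> (\<exists>g. recursive_fun g \<and> (\<forall>d n. q d n = rat_dec (g (prod_encode (enc d, n)))))"

definition computable_map :: "('d \<Rightarrow> nat) \<Rightarrow> ('d \<Rightarrow> real) \<Rightarrow> bool" where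
  "computable_map enc r \<longleftrightarrow>
     (\<exists>q. rec_rat_map enc q \<and> (\<forall>d n. \<bar>r d - q d n\<bar> < (1/2) ^ n))"

definition lsc_map :: "('d \<Rightarrow> nat) \<Rightarrow> ('d \<Rightarrow> real) \<Rightarrow> bool" where
  "lsc_map enc r \<longleftrightarrow>
     (\<exists>q. rec_rat_map enc q \<and> (\<forall>d n. q d (Suc n) \<ge> q d n) \<and> (\<forall>d. (\<lambda>n. q d n) \<longlonglongrightarrow> r d))"

definition is_iforecast :: "real set \<Rightarrow> bool" where
  "is_iforecast I \<longleftrightarrow> (\<exists>a b. 0 \<le> a \<and> a \<le> b \<and> b \<le> 1 \<and> I = {a..b})"

definition forecasting_system :: "(bool list \<Rightarrow> real set) \<Rightarrow> bool" where
  "forecasting_system \<phi> \<longleftrightarrow> (\<forall>s. is_iforecast (\<phi> s))"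

definition flo :: "(bool list \<Rightarrow> real set) \<Rightarrow> bool list \<Rightarrow> real" where
  "flo \<phi> s = Inf (\<phi> s)"

definition fhi :: "(bool list \<Rightarrow> real set) \<Rightarrow> bool list \<Rightarrow> real" where
  "fhi \<phi> s = Sup (\<phi> s)"

definition precise :: "(bool list \<Rightarrow> real set) \<Rightarrow> bool" where
  "precise \<phi> \<longleftrightarrow> (\<forall>s. flo \<phi> s = fhi \<phi> s)"

definition temporal :: "(bool list \<Rightarrow> real set) \<Rightarrow> bool" where
  "temporal \<phi> \<longleftrightarrow> (\<forall>s t. length s = length t \<longrightarrow> \<phi> s = \<phi> t)"

definition computable_fs :: "(bool list \<Rightarrow> real set) \<Rightarrow> bool" where
  "computable_fs \<phi> \<longleftrightarrow> computable_map sit_code (flo \<phi>) \<and> computable_map sit_code (fhi \<phi>)"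

definition upper_exp :: "real set \<Rightarrow> (bool \<Rightarrow> real) \<Rightarrow> real" where
  "upper_exp I f = (SUP p\<in>I. p * f True + (1 - p) * f False)"

definition supermartingale :: "(bool list \<Rightarrow> real set) \<Rightarrow> (bool list \<Rightarrow> real) \<Rightarrow> bool" where
  "supermartingale \<phi> F \<longleftrightarrow> (\<forall>s. upper_exp (\<phi> s) (\<lambda>x. F (s @ [x]) - F s) \<le> 0)"

definition test_supermartingale :: "(bool list \<Rightarrow> real set) \<Rightarrow> (bool list \<Rightarrow> real) \<Rightarrow> bool" where
  "test_supermartingale \<phi> T \<longleftrightarrow> supermartingale \<phi> T \<and> (\<forall>s. T s \<ge> 0) \<and> T [] = 1"

definition mult_gen :: "(bool list \<Rightarrow> bool \<Rightarrow> real) \<Rightarrow> bool list \<Rightarrow> real" where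
  "mult_gen D s = (\<Prod>k<length s. D (take k s) (s ! k))"

text \<open>Paths: omega_{1:n} is the list of the first n outcomes (omega k is outcome k+1).\<close>
definition prefix :: "(nat \<Rightarrow> bool) \<Rightarrow> nat \<Rightarrow> bool list" where
  "prefix \<omega> n = map \<omega> [0..<n]"

definition unbounded_on :: "(bool list \<Rightarrow> real) \<Rightarrow> (nat \<Rightarrow> bool) \<Rightarrow> bool" where
  "unbounded_on T \<omega> \<longleftrightarrow> limsup (\<lambda>n. ereal (T (prefix \<omega> n))) = \<infinity>"

definition MLrand :: "(bool list \<Rightarrow> real set) \<Rightarrow> (nat \<Rightarrow> bool) \<Rightarrow> bool" where
  "MLrand \<phi> \<omega> \<longleftrightarrow>
     \<not> (\<exists>T. lsc_map sit_code T \<and> test_supermartingale \<phi> T \<and> unbounded_on T \<omega>)"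

definition wMLrand :: "(bool list \<Rightarrow> real set) \<Rightarrow> (nat \<Rightarrow> bool) \<Rightarrow> bool" where
  "wMLrand \<phi> \<omega> \<longleftrightarrow>
     \<not> (\<exists>D. lsc_map sitx_code (\<lambda>(s, x). D s x) \<and> test_supermartingale \<phi> (mult_gen D)
            \<and> unbounded_on (mult_gen D) \<omega>)"

definition C_random :: "(bool list \<Rightarrow> real set) \<Rightarrow> (nat \<Rightarrow> bool) \<Rightarrow> bool" where
  "C_random \<phi> \<omega> \<longleftrightarrow>
     \<not> (\<exists>T. computable_map sit_code T \<and> test_supermartingale \<phi> T \<and> unbounded_on T \<omega>)"

definition S_random :: "(bool list \<Rightarrow> real set) \<Rightarrow> (nat \<Rightarrow> bool) \<Rightarrow> bool" where
  "S_random \<phi> \<omega> \<longleftrightarrow>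
     \<not> (\<exists>T \<tau>. computable_map sit_code T \<and> test_supermartingale \<phi> T
            \<and> computable_map (\<lambda>n::nat. n) \<tau> \<and> (\<forall>n. \<tau> n \<ge> 0) \<and> mono \<tau>
            \<and> \<not> bdd_above (range \<tau>)
            \<and> limsup (\<lambda>n. ereal (T (prefix \<omega> n) - \<tau> n)) \<ge> 0)"

definition recursive_sel :: "(bool list \<Rightarrow> bool) \<Rightarrow> bool" where
  "recursive_sel S \<longleftrightarrow> (\<exists>g. recursive_fun g \<and> (\<forall>s. g (sit_code s) = of_bool (S s)))"

definition temporal_sel :: "(bool list \<Rightarrow> bool) \<Rightarrow> bool" where
  "temporal_sel S \<longleftrightarrow> (\<forall>s t. length s = length t \<longrightarrow> S s = S t)"

definition sel_count :: "(bool list \<Rightarrow> bool) \<Rightarrow> (nat \<Rightarrow> bool) \<Rightarrow> nat \<Rightarrow> real" where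
  "sel_count S \<omega> n = (\<Sum>k<n. of_bool (S (prefix \<omega> k)))"

definition CH_condition :: "(bool list \<Rightarrow> real set) \<Rightarrow> (nat \<Rightarrow> bool) \<Rightarrow> (bool list \<Rightarrow> bool) \<Rightarrow> bool" where
  "CH_condition \<phi> \<omega> S \<longleftrightarrow>
     (filterlim (sel_count S \<omega>) at_top sequentially \<longrightarrow>
       liminf (\<lambda>n. ereal ((\<Sum>k<n. of_bool (S (prefix \<omega> k)) * (of_bool (\<omega> k) - flo \<phi> (prefix \<omega> k)))
                         / sel_count S \<omega> n)) \<ge> 0
     \<and> limsup (\<lambda>n. ereal ((\<Sum>k<n. of_bool (S (prefix \<omega> k)) * (of_bool (\<omega> k) - fhi \<phi> (prefix \<omega> k)))
                         / sel_count S \<omega> n)) \<le> 0)"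

definition CH_random :: "(bool list \<Rightarrow> real set) \<Rightarrow> (nat \<Rightarrow> bool) \<Rightarrow> bool" where
  "CH_random \<phi> \<omega> \<longleftrightarrow> (\<forall>S. recursive_sel S \<longrightarrow> CH_condition \<phi> \<omega> S)"

definition wCH_random :: "(bool list \<Rightarrow> real set) \<Rightarrow> (nat \<Rightarrow> bool) \<Rightarrow> bool" where
  "wCH_random \<phi> \<omega> \<longleftrightarrow> (\<forall>S. recursive_sel S \<and> temporal_sel S \<longrightarrow> CH_condition \<phi> \<omega> S)"

datatype rnotion = R_ML | R_wML | R_C | R_S | R_CH | R_wCH

fun R_random :: "rnotion \<Rightarrow> (bool list \<Rightarrow> real set) \<Rightarrow> (nat \<Rightarrow> bool) \<Rightarrow> bool" where
  "R_random R_ML = MLrand"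
| "R_random R_wML = wMLrand"
| "R_random R_C = C_random"
| "R_random R_S = S_random"
| "R_random R_CH = CH_random"
| "R_random R_wCH = wCH_random"

definition I_R :: "rnotion \<Rightarrow> (nat \<Rightarrow> bool) \<Rightarrow> real set" where
  "I_R R \<omega> = \<Inter> {I. is_iforecast I \<and> R_random R (\<lambda>_. I) \<omega>}"

definition I_phi :: "(bool list \<Rightarrow> real set) \<Rightarrow> (nat \<Rightarrow> bool) \<Rightarrow> real set" where
  "I_phi \<phi> \<omega> = {real_of_ereal (liminf (\<lambda>n. ereal (flo \<phi> (prefix \<omega> n))))
                 .. real_of_ereal (limsup (\<lambda>n. ereal (fhi \<phi> (prefix \<omega> n))))}"

end

theory Submission
  imports Defs
begin

text \<open>Replacing a forecasting system by one that is wider from some time on preserves randomness: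
  a test supermartingale for the wider system may simply be started late. Since \<open>\<phi>\<close> is precise and
  temporal, \<open>\<omega>\<close> is therefore random for every interval that contains a neighbourhood of
  \<open>I_phi \<phi> \<omega>\<close>, which gives one inclusion.

  For the other inclusion, suppose that \<open>\<omega>\<close> is random for an interval that misses, say, the limit
  superior of the forecasts. Rational approximations of the forecasts yield a recursive
  set of times, infinite, at which all forecasts exceed some \<open>hi\<close> while the interval lies below
  some \<open>lo < hi\<close>. For the frequency notions this is immediately contradictory. For the martingale
  notions, bet at these times with stake \<open>c = (hi - lo) / 2\<close> on 1 against the interval and on 0
  against \<open>\<phi>\<close>: whatever the outcome, the product of the two capitals grows by a factor of at least
  \<open>1 + c\<^sup>2\<close> at each selected time, so one of the two exceeds the number of selected times
  infinitely often.\<close>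

section \<open>Recursive functions\<close>

definition recursive_nary :: "nat \<Rightarrow> (nat list \<Rightarrow> nat) \<Rightarrow> bool" where
  "recursive_nary k f \<longleftrightarrow> (\<exists>r. \<forall>xs. length xs = k \<longrightarrow> eval_rf r xs (f xs))"

lemma recursive_nary_proj: "i < k \<Longrightarrow> recursive_nary k (\<lambda>xs. xs ! i)"
  unfolding recursive_nary_def by (auto intro!: exI[of _ "Proj i"] ev_proj)

lemma recursive_nary_comp:
  assumes f: "recursive_nary (length gs) f" and gs: "\<forall>g\<in>set gs. recursive_nary k g"
  shows "recursive_nary k (\<lambda>xs. f (map (\<lambda>g. g xs) gs))"
proof -
  obtain rf where rf: "\<And>xs. length xs = length gs \<Longrightarrow> eval_rf rf xs (f xs)"
    using f unfolding recursive_nary_def by blast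
  obtain R where R: "\<And>g xs. g \<in> set gs \<Longrightarrow> length xs = k \<Longrightarrow> eval_rf (R g) xs (g xs)"
    using gs unfolding recursive_nary_def by metis
  have "eval_rf (Comp rf (map R gs)) xs (f (map (\<lambda>g. g xs) gs))" if "length xs = k" for xs
    by (rule ev_comp[of "map (\<lambda>g. g xs) gs"]) (use that in \<open>auto intro: rf R\<close>)
  then show ?thesis unfolding recursive_nary_def by blast
qed

text \<open>The step function of a primitive recursion receives the counter and the previous value
  in front of the parameters; this makes a function of the parameters alone usable there.\<close>

lemma recursive_nary_drop2:
  assumes "recursive_nary k f"
  shows "recursive_nary (Suc (Suc k)) (\<lambda>xs. f (drop 2 xs))"
proof -
  let ?gs = "map (\<lambda>i xs. xs ! i) [2..<k+2] :: (nat list \<Rightarrow> nat) list"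
  have "recursive_nary (Suc (Suc k)) (\<lambda>xs. f (map (\<lambda>g. g xs) ?gs))"
    by (rule recursive_nary_comp)
      (use assms in \<open>auto intro: recursive_nary_proj simp del: upt_Suc\<close>)
  moreover have "map (\<lambda>g. g xs) ?gs = drop 2 xs" if "length xs = Suc (Suc k)" for xs
    using that by (intro nth_equalityI) (auto simp del: upt_Suc)
  ultimately show ?thesis by (auto simp: recursive_nary_def)
qed

lemma recursive_nary_Suc:
  assumes "recursive_nary k f"
  shows "recursive_nary k (\<lambda>xs. Suc (f xs))"
proof -
  have "recursive_nary (length [f]) (\<lambda>xs. Suc (hd xs))"
    unfolding recursive_nary_def by (auto intro!: exI[of _ Succ] ev_succ simp: length_Suc_conv)
  from recursive_nary_comp[OF this, of k] assms show ?thesis by simp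
qed

lemma recursive_nary_const: "recursive_nary k (\<lambda>xs. c)"
proof (induction c)
  case 0
  show ?case unfolding recursive_nary_def by (blast intro: ev_zero)
qed (rule recursive_nary_Suc)

text \<open>\<open>Prim\<close> recurses on its first argument only. Composing it with
  \<open>h\<close> followed by all projections lets the number of iterations be computed from the
  parameters.\<close>

lemma recursive_nary_prim:
  assumes f: "recursive_nary k f" and g: "recursive_nary (Suc (Suc k)) g" and h: "recursive_nary k h"
  shows "recursive_nary k (\<lambda>xs. rec_nat (f xs) (\<lambda>n y. g (n # y # xs)) (h xs))"
proof -
  obtain rf where rf: "\<And>xs. length xs = k \<Longrightarrow> eval_rf rf xs (f xs)"
    using f unfolding recursive_nary_def by blast
  obtain rg where rg: "\<And>xs. length xs = Suc (Suc k) \<Longrightarrow> eval_rf rg xs (g xs)"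
    using g unfolding recursive_nary_def by blast
  have step: "eval_rf (Prim rf rg) (n # xs) (rec_nat (f xs) (\<lambda>n y. g (n # y # xs)) n)"
    if "length xs = k" for n xs
    by (induction n) (use that in \<open>auto intro!: ev_prim0 ev_primS rf rg\<close>)
  have P: "recursive_nary (Suc k) (\<lambda>zs. rec_nat (f (tl zs)) (\<lambda>n y. g (n # y # tl zs)) (hd zs))"
    unfolding recursive_nary_def
    by (rule exI[of _ "Prim rf rg"]) (auto simp: length_Suc_conv intro: step)
  let ?gs = "h # map (\<lambda>i xs. xs ! i) [0..<k]"
  have "recursive_nary k (\<lambda>xs. (\<lambda>zs. rec_nat (f (tl zs)) (\<lambda>n y. g (n # y # tl zs)) (hd zs))
      (map (\<lambda>g. g xs) ?gs))"
    by (rule recursive_nary_comp) (use P h in \<open>auto intro: recursive_nary_proj\<close>)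
  moreover have "map (\<lambda>g. g xs) ?gs = h xs # xs" if "length xs = k" for xs
    using that by (intro nth_equalityI) (auto simp: nth_Cons split: nat.splits)
  ultimately show ?thesis by (auto simp: recursive_nary_def)
qed

text \<open>\<open>Mn\<close> requires a defined, positive value at every smaller argument; totality
  of \<open>f\<close> provides it.\<close>

lemma recursive_nary_least:
  assumes f: "recursive_nary (Suc k) f" and ex: "\<And>xs. length xs = k \<Longrightarrow> \<exists>n. f (n # xs) = 0"
  shows "recursive_nary k (\<lambda>xs. LEAST n. f (n # xs) = 0)"
proof -
  obtain rf where rf: "\<And>xs. length xs = Suc k \<Longrightarrow> eval_rf rf xs (f xs)"
    using f unfolding recursive_nary_def by blast
  have "eval_rf (Mn rf) xs (LEAST n. f (n # xs) = 0)" if "length xs = k" for xs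
  proof (rule ev_mn)
    have "f ((LEAST n. f (n # xs) = 0) # xs) = 0"
      by (rule LeastI_ex) (rule ex[OF that])
    then show "eval_rf rf ((LEAST n. f (n # xs) = 0) # xs) 0"
      using rf[of "(LEAST n. f (n # xs) = 0) # xs"] that by simp
    show "\<forall>m<LEAST n. f (n # xs) = 0. \<exists>y. eval_rf rf (m # xs) (Suc y)"
    proof (intro allI impI)
      fix m assume "m < (LEAST n. f (n # xs) = 0)"
      then have "f (m # xs) \<noteq> 0" by (rule not_less_Least)
      then obtain y where "f (m # xs) = Suc y" using not0_implies_Suc by blast
      then show "\<exists>y. eval_rf rf (m # xs) (Suc y)" using rf[of "m # xs"] that by auto
    qed
  qed
  then show ?thesis unfolding recursive_nary_def by blast
qed

section \<open>Arithmetic\<close>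

lemma recursive_nary_add:
  assumes "recursive_nary k f" "recursive_nary k g"
  shows "recursive_nary k (\<lambda>xs. f xs + g xs)"
proof -
  have e: "rec_nat a (\<lambda>n y. Suc y) b = a + b" for a b :: nat by (induction b) auto
  have "recursive_nary k (\<lambda>xs. rec_nat (f xs) (\<lambda>n y. (\<lambda>zs. Suc (zs ! 1)) (n # y # xs)) (g xs))"
    by (intro recursive_nary_prim assms recursive_nary_Suc recursive_nary_proj) simp
  then show ?thesis by (simp add: e)
qed

lemma recursive_nary_mult:
  assumes "recursive_nary k f" "recursive_nary k g"
  shows "recursive_nary k (\<lambda>xs. f xs * g xs)"
proof -
  have e: "rec_nat 0 (\<lambda>n y. y + a) b = a * b" for a b :: nat by (induction b) auto
  have "recursive_nary k (\<lambda>xs. rec_nat 0 (\<lambda>n y. (\<lambda>zs. zs ! 1 + f (drop 2 zs)) (n # y # xs)) (g xs))"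
    by (intro recursive_nary_prim assms recursive_nary_const recursive_nary_add recursive_nary_drop2
        recursive_nary_proj) simp
  then show ?thesis by (simp add: e)
qed

lemma recursive_nary_diff:
  assumes "recursive_nary k f" "recursive_nary k g"
  shows "recursive_nary k (\<lambda>xs. f xs - g xs)"
proof -
  have e: "rec_nat 0 (\<lambda>n y. n) a = a - 1" for a :: nat by (cases a) auto
  have pred: "recursive_nary j (\<lambda>xs. h xs - 1)" if "recursive_nary j h" for j h
  proof -
    have "recursive_nary j (\<lambda>xs. rec_nat 0 (\<lambda>n y. (\<lambda>zs. zs ! 0) (n # y # xs)) (h xs))"
      by (intro recursive_nary_prim that recursive_nary_const recursive_nary_proj) simp
    then show ?thesis by (simp add: e)
  qed
  have e2: "rec_nat a (\<lambda>n y. y - 1) b = a - b" for a b :: nat by (induction b) auto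
  have "recursive_nary k (\<lambda>xs. rec_nat (f xs) (\<lambda>n y. (\<lambda>zs. zs ! 1 - 1) (n # y # xs)) (g xs))"
    by (intro recursive_nary_prim assms pred recursive_nary_proj) simp
  then show ?thesis using e2 by simp
qed

lemma recursive_nary_triangle:
  assumes "recursive_nary k f"
  shows "recursive_nary k (\<lambda>xs. triangle (f xs))"
proof -
  have e: "rec_nat 0 (\<lambda>n y. y + Suc n) a = triangle a" for a :: nat by (induction a) auto
  have "recursive_nary k (\<lambda>xs. rec_nat 0 (\<lambda>n y. (\<lambda>zs. zs ! 1 + Suc (zs ! 0)) (n # y # xs)) (f xs))"
    by (intro recursive_nary_prim assms recursive_nary_add recursive_nary_Suc
        recursive_nary_proj recursive_nary_const) simp_all
  then show ?thesis using e by simp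
qed

lemma recursive_fun_iff_nary: "recursive_fun f \<longleftrightarrow> recursive_nary 1 (\<lambda>xs. f (hd xs))"
proof -
  have "(\<forall>xs. length xs = 1 \<longrightarrow> eval_rf r xs (f (hd xs))) \<longleftrightarrow> (\<forall>x. eval_rf r [x] (f x))" for r
    by (metis One_nat_def length_0_conv length_Cons length_Suc_conv list.sel(1))
  then show ?thesis by (simp add: recursive_nary_def recursive_fun_def)
qed

lemma recursive_fun_id: "recursive_fun (\<lambda>x. x)"
  using ev_proj[of 0 "[_]"] unfolding recursive_fun_def by force

lemma recursive_fun_const: "recursive_fun (\<lambda>x. c)"
  by (simp only: recursive_fun_iff_nary recursive_nary_const)

lemma recursive_nary_app:
  assumes "recursive_fun f" "recursive_nary k g"
  shows "recursive_nary k (\<lambda>xs. f (g xs))"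
  using recursive_nary_comp[of "[g]" "\<lambda>xs. f (hd xs)" k] assms
  by (simp add: recursive_fun_iff_nary)

lemma recursive_fun_comp:
  assumes "recursive_fun f" "recursive_fun g"
  shows "recursive_fun (\<lambda>x. f (g x))"
  using assms recursive_nary_app
  unfolding recursive_fun_iff_nary[of g] recursive_fun_iff_nary[of "\<lambda>x. f (g x)"]
  by blast

lemma recursive_fun_Suc: "recursive_fun f \<Longrightarrow> recursive_fun (\<lambda>x. Suc (f x))"
  and recursive_fun_add: "recursive_fun f \<Longrightarrow> recursive_fun g \<Longrightarrow> recursive_fun (\<lambda>x. f x + g x)"
  and recursive_fun_mult: "recursive_fun f \<Longrightarrow> recursive_fun g \<Longrightarrow> recursive_fun (\<lambda>x. f x * g x)"
  and recursive_fun_diff: "recursive_fun f \<Longrightarrow> recursive_fun g \<Longrightarrow> recursive_fun (\<lambda>x. f x - g x)"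
  and recursive_fun_triangle: "recursive_fun f \<Longrightarrow> recursive_fun (\<lambda>x. triangle (f x))"
  by (simp_all only: recursive_fun_iff_nary recursive_nary_Suc recursive_nary_add
      recursive_nary_mult recursive_nary_diff recursive_nary_triangle)

section \<open>Pairing and unpairing\<close>

lemma recursive_nary_prod_encode:
  assumes "recursive_nary k f" "recursive_nary k g"
  shows "recursive_nary k (\<lambda>xs. prod_encode (f xs, g xs))"
  using recursive_nary_add[OF recursive_nary_triangle[OF recursive_nary_add] assms(1)] assms
  by (simp add: prod_encode_def)

lemma recursive_fun_prod_encode:
  "recursive_fun f \<Longrightarrow> recursive_fun g \<Longrightarrow> recursive_fun (\<lambda>x. prod_encode (f x, g x))"
  by (simp only: recursive_fun_iff_nary recursive_nary_prod_encode)

text \<open>The antidiagonal \<open>a + b\<close> on which \<open>prod_encode (a, b)\<close> lies,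
  namely the least \<open>n\<close> with \<open>z < triangle (Suc n)\<close>. The comparison is
  written as a zero test in truncated subtraction, the form that minimisation accepts.\<close>

definition diagonal :: "nat \<Rightarrow> nat" where
  "diagonal z = (LEAST n. Suc z - triangle (Suc n) = 0)"

lemma triangle_mono: "m \<le> n \<Longrightarrow> triangle m \<le> triangle n"
  by (rule lift_Suc_mono_le[of triangle]) auto

lemma diagonal_prod_encode: "diagonal (prod_encode (a, b)) = a + b"
  unfolding diagonal_def
proof (rule Least_equality)
  show "Suc (prod_encode (a, b)) - triangle (Suc (a + b)) = 0" by (simp add: prod_encode_def)
  fix n assume n: "Suc (prod_encode (a, b)) - triangle (Suc n) = 0"
  show "a + b \<le> n"
  proof (rule ccontr)
    assume "\<not> a + b \<le> n"
    then have "triangle (Suc n) \<le> triangle (a + b)" by (intro triangle_mono) simp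
    with n show False by (simp add: prod_encode_def)
  qed
qed

lemma recursive_fun_diagonal: "recursive_fun diagonal"
proof -
  have le: "n \<le> triangle n" for n by (induction n) auto
  have "recursive_nary 1 (\<lambda>xs. LEAST n. (\<lambda>zs. Suc (zs ! 1) - triangle (Suc (zs ! 0))) (n # xs) = 0)"
  proof (rule recursive_nary_least)
    show "\<exists>n. Suc ((n # xs) ! 1) - triangle (Suc ((n # xs) ! 0)) = 0" for xs
      using le[of "Suc (xs ! 0)"] by (intro exI[of _ "xs ! 0"]) simp
  qed (intro recursive_nary_diff recursive_nary_Suc recursive_nary_triangle recursive_nary_proj, simp_all)
  then show ?thesis
    unfolding recursive_fun_iff_nary recursive_nary_def diagonal_def
    by (elim ex_forward) (auto simp: length_Suc_conv)
qed

abbreviation pfst :: "nat \<Rightarrow> nat" where "pfst z \<equiv> fst (prod_decode z)"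
abbreviation psnd :: "nat \<Rightarrow> nat" where "psnd z \<equiv> snd (prod_decode z)"

lemma pfst_eq: "pfst z = z - triangle (diagonal z)"
  and psnd_eq: "psnd z = diagonal z - (z - triangle (diagonal z))"
proof -
  obtain a b where "z = prod_encode (a, b)" by (metis prod_decode_inverse surj_pair)
  then show "pfst z = z - triangle (diagonal z)" "psnd z = diagonal z - (z - triangle (diagonal z))"
    by (simp_all add: diagonal_prod_encode) (simp_all add: prod_encode_def)
qed

lemma recursive_fun_pfst: "recursive_fun f \<Longrightarrow> recursive_fun (\<lambda>x. pfst (f x))"
  and recursive_fun_psnd: "recursive_fun f \<Longrightarrow> recursive_fun (\<lambda>x. psnd (f x))"
  unfolding pfst_eq psnd_eq
  by (intro recursive_fun_diff recursive_fun_triangle recursive_fun_comp[OF recursive_fun_diagonal];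
      assumption)+

text \<open>The three arguments of the step function are packed into one code, so that its
  recursiveness can again be derived by the closure rules for unary functions.\<close>

lemma recursive_fun_rec_nat:
  assumes "recursive_fun a" "recursive_fun h"
    and b: "recursive_fun (\<lambda>z. b (pfst z) (pfst (psnd z)) (psnd (psnd z)))"
  shows "recursive_fun (\<lambda>x. rec_nat (a x) (\<lambda>n y. b n y x) (h x))"
proof -
  let ?b = "\<lambda>z. b (pfst z) (pfst (psnd z)) (psnd (psnd z))"
  have "recursive_nary 1 (\<lambda>xs. rec_nat (a (hd xs))
      (\<lambda>n y. (\<lambda>zs. ?b (prod_encode (zs ! 0, prod_encode (zs ! 1, zs ! 2)))) (n # y # xs)) (h (hd xs)))"
    using assms(1,2)
    by (intro recursive_nary_prim recursive_nary_app[OF b] recursive_nary_prod_encode recursive_nary_proj)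
      (simp_all add: recursive_fun_iff_nary)
  then show ?thesis
    unfolding recursive_fun_iff_nary recursive_nary_def
    by (elim ex_forward) (auto simp: length_Suc_conv)
qed

section \<open>Recursive predicates and case distinctions\<close>

lemma recursive_fun_not:
  assumes "recursive_fun (\<lambda>x. of_bool (P x))"
  shows "recursive_fun (\<lambda>x. of_bool (\<not> P x))"
proof -
  have "recursive_fun (\<lambda>x. 1 - of_bool (P x))"
    by (intro recursive_fun_diff recursive_fun_const assms)
  moreover have "1 - of_bool (P x) = (of_bool (\<not> P x) :: nat)" for x by simp
  ultimately show ?thesis by (simp only:)
qed

lemma recursive_fun_conj:
  assumes "recursive_fun (\<lambda>x. of_bool (P x))" "recursive_fun (\<lambda>x. of_bool (Q x))"
  shows "recursive_fun (\<lambda>x. of_bool (P x \<and> Q x))"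
  using recursive_fun_mult[OF assms] by (simp add: of_bool_conj)

lemma recursive_fun_less:
  assumes "recursive_fun f" "recursive_fun g"
  shows "recursive_fun (\<lambda>x. of_bool (f x < g x))"
proof -
  have "recursive_fun (\<lambda>x. 1 - (1 - (g x - f x)))"
    by (intro recursive_fun_diff recursive_fun_const assms)
  moreover have "1 - (1 - (g x - f x)) = of_bool (f x < g x)" for x by (simp add: of_bool_def)
  ultimately show ?thesis by (simp only:)
qed

lemma recursive_fun_eq:
  assumes "recursive_fun f" "recursive_fun g"
  shows "recursive_fun (\<lambda>x. of_bool (f x = g x))"
proof -
  have "(f x = g x) = (\<not> f x < g x \<and> \<not> g x < f x)" for x by auto
  then show ?thesis
    by (simp only: recursive_fun_conj recursive_fun_not recursive_fun_less assms)
qed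

lemma recursive_fun_if:
  assumes "recursive_fun (\<lambda>x. of_bool (P x))" "recursive_fun f" "recursive_fun g"
  shows "recursive_fun (\<lambda>x. if P x then f x else g x)"
proof -
  have "recursive_fun (\<lambda>x. of_bool (P x) * f x + of_bool (\<not> P x) * g x)"
    by (intro recursive_fun_add recursive_fun_mult recursive_fun_not assms)
  moreover have "of_bool (P x) * f x + of_bool (\<not> P x) * g x = (if P x then f x else g x)" for x by simp
  ultimately show ?thesis by (simp only:)
qed

lemma recursive_fun_even:
  assumes "recursive_fun f"
  shows "recursive_fun (\<lambda>x. of_bool (even (f x)))"
proof -
  have e: "rec_nat 1 (\<lambda>n y. 1 - y) a = (of_bool (even a) :: nat)" for a :: nat
    by (induction a) (simp_all add: of_bool_def)
  have "recursive_fun (\<lambda>x. rec_nat 1 (\<lambda>n y. 1 - y) (f x))"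
    by (intro recursive_fun_rec_nat recursive_fun_diff recursive_fun_const recursive_fun_pfst
        recursive_fun_psnd recursive_fun_id assms)
  then show ?thesis by (simp only: e)
qed

lemma recursive_fun_power:
  assumes "recursive_fun f"
  shows "recursive_fun (\<lambda>x. c ^ f x)"
proof -
  have e: "rec_nat 1 (\<lambda>n y. c * y) a = c ^ a" for a :: nat by (induction a) auto
  have "recursive_fun (\<lambda>x. rec_nat 1 (\<lambda>n y. c * y) (f x))"
    by (intro recursive_fun_rec_nat recursive_fun_mult recursive_fun_const recursive_fun_pfst
        recursive_fun_psnd recursive_fun_id assms)
  then show ?thesis by (simp only: e)
qed

lemmas recursive_fun_intros = recursive_fun_id recursive_fun_const recursive_fun_Suc
  recursive_fun_add recursive_fun_mult recursive_fun_diff recursive_fun_prod_encode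
  recursive_fun_pfst recursive_fun_psnd recursive_fun_not recursive_fun_conj recursive_fun_less
  recursive_fun_eq recursive_fun_if recursive_fun_even recursive_fun_power

section \<open>Recursion along coded lists\<close>

lemma length_le_list_encode: "length xs \<le> list_encode xs"
proof (induction xs)
  case (Cons x xs)
  then show ?case using le_prod_encode_2[of "list_encode xs" x] by simp
qed simp

text \<open>The state pairs the code of the remaining list with the accumulator, and each step
  consumes one element. The empty list has code 0 and leaves the state fixed, so surplus iterations
  are harmless; the code of the list bounds its length and serves as the number of
  iterations.\<close>

lemma recursive_fun_foldl:
  assumes "recursive_fun G"
  obtains H where "recursive_fun H"
    "\<And>xs. H (list_encode xs) = foldl (\<lambda>y x. G (prod_encode (y, x))) c xs"
proof -
  define step where "step st = (if pfst st = 0 then st else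
    prod_encode (psnd (pfst st - 1), G (prod_encode (psnd st, pfst (pfst st - 1)))))" for st
  define H where "H z = psnd (rec_nat (prod_encode (z, c)) (\<lambda>n st. step st) z)" for z
  have step_rec: "recursive_fun (\<lambda>x. step (f x))" if "recursive_fun f" for f
    unfolding step_def by (intro recursive_fun_intros recursive_fun_comp[OF assms] that)
  have "recursive_fun H"
    unfolding H_def by (intro recursive_fun_psnd recursive_fun_rec_nat step_rec recursive_fun_intros)
  moreover have "H (list_encode xs) = foldl (\<lambda>y x. G (prod_encode (y, x))) c xs" for xs
  proof -
    have rec: "rec_nat a (\<lambda>n st. step st) n = (step ^^ n) a" for a n by (induction n) auto
    have "(step ^^ n) (prod_encode (list_encode xs, y))
        = prod_encode (0, foldl (\<lambda>y x. G (prod_encode (y, x))) y xs)" if "length xs \<le> n" for n xs y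
      using that
    proof (induction n arbitrary: xs y)
      case 0
      then show ?case by simp
    next
      case (Suc n)
      show ?case
      proof (cases xs)
        case Nil
        then show ?thesis using Suc.IH[of "[]" y] by (simp add: step_def)
      next
        case (Cons x xs')
        have "step (prod_encode (list_encode xs, y)) = prod_encode (list_encode xs', G (prod_encode (y, x)))"
          by (simp add: step_def Cons)
        then show ?thesis using Suc.IH[of xs'] Suc.prems Cons
          by (simp add: funpow_Suc_right del: funpow.simps)
      qed
    qed
    then show ?thesis unfolding H_def rec by (simp add: length_le_list_encode)
  qed
  ultimately show thesis using that by blast
qed

section \<open>Computable maps\<close>

text \<open>Even codes decode to the nonnegative integers, and a denominator is stored as its
  predecessor. This explains the factor 2 and the offset 1 in all codes of rationals below.\<close>

lemma rat_dec_encode_even: "rat_dec (prod_encode (2 * a, b)) = real a / real (Suc b)"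
  by (simp add: rat_dec_def int_decode_def sum_decode_def)

text \<open>Cross-multiplication turns the comparison with a fixed nonnegative rational into
  arithmetic on natural numbers, hence into a recursive test. Odd codes have negative numerators and
  fail it.\<close>

lemma less_rat_dec_iff:
  assumes "M > 0"
  shows "real A / real M < rat_dec c \<longleftrightarrow> even (pfst c) \<and> 2 * A * Suc (psnd c) < pfst c * M"
proof (cases "even (pfst c)")
  case True
  then obtain a where a: "pfst c = 2 * a" by blast
  have "c = prod_encode (2 * a, psnd c)" by (metis a prod.collapse prod_decode_inverse)
  then have "rat_dec c = real a / real (Suc (psnd c))" by (metis rat_dec_encode_even)
  moreover have "real A / real M < real a / real (Suc b) \<longleftrightarrow> A * Suc b < a * M" for b
    using assms by (simp add: field_simps flip: of_nat_mult of_nat_add of_nat_Suc del: of_nat_Suc)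
  moreover have "2 * A * Suc b < 2 * a * M \<longleftrightarrow> A * Suc b < a * M" for b
    by (simp add: mult.assoc) arith
  ultimately show ?thesis by (simp add: a del: mult_Suc_right)
next
  case False
  then have "rat_dec c \<le> 0"
    by (auto simp: rat_dec_def int_decode_def sum_decode_def split_beta intro!: divide_nonpos_pos)
  moreover have "0 \<le> real A / real M" by simp
  ultimately show ?thesis using False by linarith
qed

text \<open>A rational value that is computed exactly is its own approximation at every stage: the
  constant sequence has error 0 and is non-decreasing.\<close>

lemma exact_rational_map:
  assumes h: "recursive_fun h" and T: "\<And>d. T d = rat_dec (h (enc d))"
  shows "computable_map enc T" "lsc_map enc T"
proof -
  have "rec_rat_map enc (\<lambda>d n. T d)"
    unfolding rec_rat_map_def T
    by (rule exI[of _ "\<lambda>z. h (pfst z)"]) (simp add: recursive_fun_comp[OF h] recursive_fun_intros)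
  then show "computable_map enc T" "lsc_map enc T"
    unfolding computable_map_def lsc_map_def by (intro exI[of _ "\<lambda>d n. T d"]; simp)+
qed

lemma rec_rat_map_divide:
  assumes "rec_rat_map enc q" "c > 0"
  shows "rec_rat_map enc (\<lambda>d n. q d n / real c)"
proof -
  obtain g where g: "recursive_fun g" "\<And>d n. q d n = rat_dec (g (prod_encode (enc d, n)))"
    using assms(1) unfolding rec_rat_map_def by blast
  define h where "h z = prod_encode (pfst (g z), Suc (psnd (g z)) * c - 1)" for z
  have "recursive_fun h"
    unfolding h_def by (intro recursive_fun_intros g)
  moreover have "rat_dec (h z) = rat_dec (g z) / real c" for z
  proof -
    have "real (Suc (Suc b * c - 1)) = real (Suc b) * real c" for b
      using assms(2) by (simp flip: of_nat_mult of_nat_Suc del: of_nat_Suc)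
    then show ?thesis by (simp add: rat_dec_def h_def split_beta del: of_nat_Suc)
  qed
  ultimately show ?thesis unfolding rec_rat_map_def g(2) by (intro exI[of _ h]) simp
qed

lemma computable_map_divide:
  assumes "computable_map enc T" "c > 0"
  shows "computable_map enc (\<lambda>d. T d / real c)"
proof -
  obtain q where q: "rec_rat_map enc q" "\<And>d n. \<bar>T d - q d n\<bar> < (1/2) ^ n"
    using assms(1) unfolding computable_map_def by blast
  have "\<bar>T d / real c - q d n / real c\<bar> < (1/2) ^ n" for d n
  proof -
    have "\<bar>T d / real c - q d n / real c\<bar> = \<bar>T d - q d n\<bar> / real c"
      by (simp add: diff_divide_distrib[symmetric])
    also have "\<dots> \<le> \<bar>T d - q d n\<bar>" using assms(2) by (simp add: divide_le_eq mult_left_le mult_le_cancel_left1)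
    finally show ?thesis using q(2)[of d n] by linarith
  qed
  then show ?thesis using rec_rat_map_divide[OF q(1) assms(2)] unfolding computable_map_def by blast
qed

lemma lsc_map_divide:
  assumes "lsc_map enc T" "c > 0"
  shows "lsc_map enc (\<lambda>d. T d / real c)"
proof -
  obtain q where q: "rec_rat_map enc q" "\<And>d n. q d (Suc n) \<ge> q d n" "\<And>d. (\<lambda>n. q d n) \<longlonglongrightarrow> T d"
    using assms(1) unfolding lsc_map_def by blast
  have "(\<lambda>n. q d n / real c) \<longlonglongrightarrow> T d / real c" for d
    using assms(2) by (intro tendsto_intros q) simp
  then show ?thesis using rec_rat_map_divide[OF q(1) assms(2)] q(2)
    unfolding lsc_map_def by (intro exI[of _ "\<lambda>d n. q d n / real c"]) (simp add: divide_right_mono)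
qed

section \<open>Changing finitely many values\<close>

lemma rec_rat_map_update:
  assumes "rec_rat_map enc q" "inj enc"
  shows "rec_rat_map enc (q(d := \<lambda>n. real v))"
proof -
  obtain g where g: "recursive_fun g" "\<And>d n. q d n = rat_dec (g (prod_encode (enc d, n)))"
    using assms(1) unfolding rec_rat_map_def by blast
  define h where "h z = (if pfst z = enc d then prod_encode (2 * v, 0) else g z)" for z
  have "recursive_fun h"
    unfolding h_def by (intro recursive_fun_intros g)
  moreover have "(q(d := \<lambda>n. real v)) e n = rat_dec (h (prod_encode (enc e, n)))" for e n
    using assms(2) by (auto simp: h_def rat_dec_encode_even g(2) inj_eq)
  ultimately show ?thesis unfolding rec_rat_map_def by blast
qed

lemma computable_map_update:
  assumes "computable_map enc T" "inj enc"
  shows "computable_map enc (T(d := real v))"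
proof -
  obtain q where q: "rec_rat_map enc q" "\<And>d n. \<bar>T d - q d n\<bar> < (1/2) ^ n"
    using assms(1) unfolding computable_map_def by blast
  with rec_rat_map_update[OF q(1) assms(2), of d v] show ?thesis
    unfolding computable_map_def by (intro exI[of _ "q(d := \<lambda>n. real v)"]) simp
qed

lemma lsc_map_update:
  assumes "lsc_map enc T" "inj enc"
  shows "lsc_map enc (T(d := real v))"
proof -
  obtain q where q: "rec_rat_map enc q" "\<And>d n. q d (Suc n) \<ge> q d n" "\<And>d. (\<lambda>n. q d n) \<longlonglongrightarrow> T d"
    using assms(1) unfolding lsc_map_def by blast
  with rec_rat_map_update[OF q(1) assms(2), of d v] show ?thesis
    unfolding lsc_map_def by (intro exI[of _ "q(d := \<lambda>n. real v)"]) simp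
qed

text \<open>One update per element of \<open>A\<close>. The predicate is left abstract to serve for
  computability and lower semicomputability, on situations as well as on pairs of a situation and an
  outcome.\<close>

lemma finite_modification:
  fixes f :: "'d \<Rightarrow> nat"
  assumes "\<And>T d v. P T \<Longrightarrow> P (T(d := real v))" "finite A" "P T"
  shows "P (\<lambda>d. if d \<in> A then real (f d) else T d)"
  using assms(2)
proof induction
  case empty
  then show ?case using assms(3) by simp
next
  case (insert a A)
  have "(\<lambda>d. if d \<in> insert a A then real (f d) else T d)
      = (\<lambda>d. if d \<in> A then real (f d) else T d)(a := real (f a))" by auto
  then show ?case using assms(1)[OF insert.IH] by simp
qed

section \<open>Codes of situations and thresholds of computable forecasts\<close>

lemma inj_sit_code: "inj sit_code"
proof -
  have "inj (of_bool :: bool \<Rightarrow> nat)" by (auto simp: inj_def)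
  then show ?thesis by (auto simp: inj_def sit_code_def list_encode_eq inj_map_eq_map)
qed

lemma inj_sitx_code: "inj sitx_code"
  using inj_sit_code by (auto simp: inj_def sitx_code_def)

lemma recursive_sit_length:
  obtains L where "recursive_fun L" "\<And>s. L (sit_code s) = length s"
proof -
  have "recursive_fun (\<lambda>z. Suc (pfst z))" by (intro recursive_fun_intros)
  then obtain L where L: "recursive_fun L" "\<And>xs. L (list_encode xs)
      = foldl (\<lambda>y x. Suc (pfst (prod_encode (y, x)))) 0 xs"
    using recursive_fun_foldl[where c = 0] by blast
  have "foldl (\<lambda>y x. Suc (pfst (prod_encode (y, x)))) n xs = n + length xs" for n xs
    by (induction xs arbitrary: n) auto
  then show thesis using that[of L] L by (simp add: sit_code_def)
qed

text \<open>The all-zero situation of length \<open>k\<close> represents time \<open>k\<close>: a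
  temporal forecasting system is determined by its values there.\<close>

lemma recursive_sit_code_replicate: "recursive_fun (\<lambda>k. sit_code (replicate k False))"
proof -
  have e: "rec_nat 0 (\<lambda>n y. Suc (prod_encode (0, y))) k = sit_code (replicate k False)" for k
    by (induction k) (auto simp: sit_code_def)
  have "recursive_fun (\<lambda>k. rec_nat 0 (\<lambda>n y. Suc (prod_encode (0, y))) k)"
    by (intro recursive_fun_rec_nat recursive_fun_intros)
  then show ?thesis by (simp only: e)
qed

lemma recursive_sel_length:
  assumes "recursive_fun (\<lambda>k. of_bool (sel k))"
  shows "recursive_sel (\<lambda>s. sel (length s))"
proof -
  obtain L where L: "recursive_fun L" "\<And>s. L (sit_code s) = length s"
    using recursive_sit_length by blast
  then show ?thesis unfolding recursive_sel_def
    by (intro exI[of _ "\<lambda>z. of_bool (sel (L z))"]) (simp add: recursive_fun_comp[OF assms])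
qed

text \<open>Whether a computable real exceeds \<open>r\<close> is undecidable in general. Comparing
  one approximation of accuracy \<open>(1/2) ^ m\<close> with \<open>r\<close> is decidable, at the
  price of two bounds that overlap near \<open>r\<close>.\<close>

lemma recursive_threshold:
  assumes "computable_map sit_code p" and "0 \<le> r" "r \<in> \<rat>"
  obtains sel where "recursive_fun (\<lambda>k. of_bool (sel k))"
    "\<And>k. sel k \<Longrightarrow> r - (1/2) ^ m < p (replicate k False)"
    "\<And>k. \<not> sel k \<Longrightarrow> p (replicate k False) < r + (1/2) ^ m"
proof -
  obtain A M where AM: "M \<noteq> 0" "r = real A / real M"
    using Rats_abs_nat_div_natE[OF assms(3)] assms(2) by (metis abs_of_nonneg)
  obtain q where q: "rec_rat_map sit_code q" "\<And>d n. \<bar>p d - q d n\<bar> < (1/2) ^ n"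
    using assms(1) unfolding computable_map_def by blast
  then obtain g where g: "recursive_fun g" "\<And>d n. q d n = rat_dec (g (prod_encode (sit_code d, n)))"
    unfolding rec_rat_map_def by blast
  define sel where "sel k \<longleftrightarrow> r < q (replicate k False) m" for k
  have "recursive_fun (\<lambda>k. of_bool (sel k))"
    unfolding sel_def g(2) AM(2) less_rat_dec_iff[OF AM(1)[unfolded neq0_conv]]
    by (intro recursive_fun_intros recursive_fun_comp[OF g(1)] recursive_sit_code_replicate)
  moreover have "r - (1/2) ^ m < p (replicate k False)" if "sel k" for k
    using q(2)[of "replicate k False" m] that unfolding sel_def by linarith
  moreover have "p (replicate k False) < r + (1/2) ^ m" if "\<not> sel k" for k
    using q(2)[of "replicate k False" m] that unfolding sel_def by linarith
  ultimately show thesis using that by blast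
qed

section \<open>Betting with fixed factors at selected times\<close>

definition bet :: "(nat \<Rightarrow> bool) \<Rightarrow> real \<Rightarrow> real \<Rightarrow> bool list \<Rightarrow> bool \<Rightarrow> real" where
  "bet sel u v s x = (if sel (length s) then if x then u else v else 1)"

lemma mult_gen_Nil [simp]: "mult_gen D [] = 1"
  by (simp add: mult_gen_def)

lemma mult_gen_snoc [simp]: "mult_gen D (s @ [x]) = mult_gen D s * D s x"
  unfolding mult_gen_def by (simp add: nth_append)

lemma Rats_common_denominator:
  assumes "u \<in> \<rat>" "v \<in> \<rat>" "0 \<le> u" "0 \<le> v"
  obtains U V M :: nat where "M > 0" "u = real U / real M" "v = real V / real M"
proof -
  obtain A B where AB: "B \<noteq> 0" "u = real A / real B"
    using Rats_abs_nat_div_natE[OF assms(1)] assms(3) by (metis abs_of_nonneg)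
  obtain C D where CD: "D \<noteq> 0" "v = real C / real D"
    using Rats_abs_nat_div_natE[OF assms(2)] assms(4) by (metis abs_of_nonneg)
  show thesis using AB CD by (intro that[of "B * D" "A * D" "C * B"]) auto
qed

text \<open>Over a common denominator \<open>M\<close> every factor, including 1, is a natural
  number divided by \<open>M\<close>. The capital after \<open>n\<close> steps is then a natural
  number divided by \<open>M ^ n\<close>, and its numerator is computed exactly by a fold along the
  situation.\<close>

lemma bet_computable:
  assumes sel: "recursive_fun (\<lambda>k. of_bool (sel k))"
    and uv: "u \<in> \<rat>" "v \<in> \<rat>" "0 \<le> u" "0 \<le> v"
  shows "lsc_map sitx_code (\<lambda>(s, x). bet sel u v s x)"
    and "lsc_map sit_code (mult_gen (bet sel u v))"
    and "computable_map sit_code (mult_gen (bet sel u v))"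
proof -
  obtain U V M where M: "M > 0" "u = real U / real M" "v = real V / real M"
    using Rats_common_denominator[OF uv] by blast
  define w where "w k x = (if sel k then if 0 < x then U else V else M)" for k x :: nat
  have w: "bet sel u v s x = real (w (length s) (of_bool x)) / real M" for s x
    using M by (simp add: bet_def w_def)
  obtain L where L: "recursive_fun L" "\<And>s. L (sit_code s) = length s"
    using recursive_sit_length by blast
  have w_rec: "recursive_fun (\<lambda>z. w (f z) (g z))" if "recursive_fun f" "recursive_fun g" for f g
    unfolding w_def by (intro recursive_fun_intros recursive_fun_comp[OF sel] that)

  have "recursive_fun (\<lambda>z. prod_encode (2 * w (L (pfst z)) (psnd z), M - 1))"
    by (intro recursive_fun_intros w_rec recursive_fun_comp[OF L(1)])
  then show "lsc_map sitx_code (\<lambda>(s, x). bet sel u v s x)"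
    by (rule exact_rational_map(2))
      (use M(1) in \<open>simp add: sitx_code_def L(2) w rat_dec_encode_even split_beta del: of_nat_Suc\<close>)

  \<comment> \<open>The factor depends on the time, so the fold carries the number of outcomes read
    so far next to the numerator.\<close>
  define G where "G z = prod_encode (Suc (pfst (pfst z)), psnd (pfst z) * w (pfst (pfst z)) (psnd z))" for z
  have "recursive_fun G" unfolding G_def by (intro recursive_fun_intros w_rec)
  then obtain H where H: "recursive_fun H" "\<And>xs. H (list_encode xs)
      = foldl (\<lambda>y x. G (prod_encode (y, x))) (prod_encode (0, 1)) xs"
    using recursive_fun_foldl[where c = "prod_encode (0, 1)"] by blast
  have H': "H (sit_code s) = prod_encode (length s, psnd (H (sit_code s)))
      \<and> mult_gen (bet sel u v) s = real (psnd (H (sit_code s))) / real (M ^ length s)" for s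
  proof (induction s rule: rev_induct)
    case Nil
    then show ?case using H(2)[of "[]"] by (simp add: sit_code_def)
  next
    case (snoc x s)
    have "H (sit_code (s @ [x])) = G (prod_encode (H (sit_code s), of_bool x))"
      by (simp add: H(2) sit_code_def)
    also have "\<dots> = prod_encode (Suc (length s), psnd (H (sit_code s)) * w (length s) (of_bool x))"
      by (subst snoc.IH[THEN conjunct1]) (simp add: G_def)
    finally show ?case using snoc.IH by (simp add: w)
  qed
  have h: "recursive_fun (\<lambda>z. prod_encode (2 * psnd (H z), M ^ L z - 1))"
    by (intro recursive_fun_intros H L)
  have e: "mult_gen (bet sel u v) s = rat_dec (prod_encode (2 * psnd (H (sit_code s)), M ^ L (sit_code s) - 1))" for s
    using H'[of s] M(1) by (simp add: L(2) rat_dec_encode_even del: of_nat_Suc)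
  show "lsc_map sit_code (mult_gen (bet sel u v))" "computable_map sit_code (mult_gen (bet sel u v))"
    using exact_rational_map[where enc = sit_code and T = "mult_gen (bet sel u v)", OF h e]
    by simp_all
qed

text \<open>The number of selected times will be the growth function \<open>\<tau>\<close> against
  which S-randomness is tested.\<close>

lemma count_computable:
  assumes sel: "recursive_fun (\<lambda>k. of_bool (sel k))"
  shows "computable_map (\<lambda>n::nat. n) (\<lambda>n. \<Sum>k<n. of_bool (sel k))"
proof -
  have e: "rec_nat 0 (\<lambda>n y. y + of_bool (sel n)) k = (\<Sum>i<k. of_bool (sel i) :: nat)" for k
    by (induction k) auto
  have "recursive_fun (\<lambda>k. rec_nat 0 (\<lambda>n y. y + of_bool (sel n)) k)"
    by (intro recursive_fun_rec_nat recursive_fun_intros recursive_fun_comp[OF sel])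
  then have "recursive_fun (\<lambda>k. \<Sum>i<k. of_bool (sel i))" by (simp only: e)
  then have "recursive_fun (\<lambda>k. prod_encode (2 * (\<Sum>i<k. of_bool (sel i)), 0))"
    by (intro recursive_fun_intros)
  then show ?thesis
    by (rule exact_rational_map(1)) (simp only: rat_dec_encode_even, simp)
qed

section \<open>Separated forecasts\<close>

lemma is_iforecastD:
  assumes "is_iforecast I"
  shows "I \<noteq> {}" "I \<subseteq> {0..1}"
  using assms unfolding is_iforecast_def by auto

text \<open>\<open>I\<close> is nonempty and lies in the unit interval, so the expectations are
  bounded above and the supremum is a genuine least upper bound.\<close>

lemma upper_exp_le_0_iff:
  assumes "is_iforecast I"
  shows "upper_exp I f \<le> 0 \<longleftrightarrow> (\<forall>p\<in>I. p * f True + (1 - p) * f False \<le> 0)"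
proof -
  have "bdd_above ((\<lambda>p. p * f True + (1 - p) * f False) ` I)"
  proof (rule bdd_aboveI2)
    fix p assume "p \<in> I"
    then have p: "0 \<le> p" "p \<le> 1" using is_iforecastD(2)[OF assms] by auto
    have "p * f True \<le> 1 * \<bar>f True\<bar>" "(1 - p) * f False \<le> 1 * \<bar>f False\<bar>"
      by (rule order_trans[OF mult_left_mono[OF abs_ge_self] mult_right_mono]; use p in simp)+
    then show "p * f True + (1 - p) * f False \<le> \<bar>f True\<bar> + \<bar>f False\<bar>" by simp
  qed
  then show ?thesis
    unfolding upper_exp_def using is_iforecastD(1)[OF assms] by (subst cSUP_le_iff) auto
qed

lemma supermartingale_iff:
  assumes "forecasting_system \<phi>"
  shows "supermartingale \<phi> F \<longleftrightarrow>
    (\<forall>s. \<forall>p\<in>\<phi> s. p * F (s @ [True]) + (1 - p) * F (s @ [False]) \<le> F s)"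
proof -
  have "upper_exp (\<phi> s) (\<lambda>x. F (s @ [x]) - F s) \<le> 0 \<longleftrightarrow>
      (\<forall>p\<in>\<phi> s. p * F (s @ [True]) + (1 - p) * F (s @ [False]) \<le> F s)" for s
    using assms unfolding forecasting_system_def
    by (subst upper_exp_le_0_iff) (auto simp: algebra_simps)
  then show ?thesis by (simp add: supermartingale_def)
qed

lemma flo_le_fhi_bounds:
  assumes "forecasting_system \<phi>"
  shows "0 \<le> flo \<phi> s" "flo \<phi> s \<le> fhi \<phi> s" "fhi \<phi> s \<le> 1" "\<phi> s = {flo \<phi> s..fhi \<phi> s}"
proof -
  obtain a b where "0 \<le> a" "a \<le> b" "b \<le> 1" "\<phi> s = {a..b}"
    using assms unfolding forecasting_system_def is_iforecast_def by blast
  then show "0 \<le> flo \<phi> s" "flo \<phi> s \<le> fhi \<phi> s" "fhi \<phi> s \<le> 1" "\<phi> s = {flo \<phi> s..fhi \<phi> s}"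
    by (auto simp: flo_def fhi_def)
qed

lemma mult_gen_bet_nonneg: "0 \<le> u \<Longrightarrow> 0 \<le> v \<Longrightarrow> 0 \<le> mult_gen (bet sel u v) s"
  unfolding mult_gen_def bet_def by (intro prod_nonneg) auto

text \<open>At unselected times the factor is 1 and the capital stays constant, so only the selected
  times impose a condition.\<close>

lemma bet_test_supermartingale:
  assumes "forecasting_system \<phi>" "0 \<le> u" "0 \<le> v"
    and le: "\<And>s p. sel (length s) \<Longrightarrow> p \<in> \<phi> s \<Longrightarrow> p * u + (1 - p) * v \<le> 1"
  shows "test_supermartingale \<phi> (mult_gen (bet sel u v))"
proof -
  have "p * mult_gen (bet sel u v) (s @ [True]) + (1 - p) * mult_gen (bet sel u v) (s @ [False])
      \<le> mult_gen (bet sel u v) s" if "p \<in> \<phi> s" for s p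
  proof (cases "sel (length s)")
    case True
    have "mult_gen (bet sel u v) s * (p * u + (1 - p) * v) \<le> mult_gen (bet sel u v) s"
      using le[OF True that] mult_gen_bet_nonneg[OF assms(2,3)] by (rule mult_left_le)
    then show ?thesis using True by (simp add: bet_def algebra_simps)
  qed (simp add: bet_def algebra_simps)
  then show ?thesis
    by (simp add: test_supermartingale_def supermartingale_iff[OF assms(1)] mult_gen_bet_nonneg assms)
qed

lemma unbounded_on_iff:
  "unbounded_on T \<omega> \<longleftrightarrow> (\<forall>B. \<exists>\<^sub>F n in sequentially. B < T (prefix \<omega> n))"
proof
  assume u: "unbounded_on T \<omega>"
  show "\<forall>B. \<exists>\<^sub>F n in sequentially. B < T (prefix \<omega> n)"
  proof (rule allI, rule ccontr)
    fix B assume "\<not> (\<exists>\<^sub>F n in sequentially. B < T (prefix \<omega> n))"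
    then have "\<forall>\<^sub>F n in sequentially. ereal (T (prefix \<omega> n)) \<le> ereal B"
      by (simp add: frequently_def not_less)
    then have "limsup (\<lambda>n. ereal (T (prefix \<omega> n))) \<le> ereal B" by (rule Limsup_bounded)
    with u show False by (simp add: unbounded_on_def)
  qed
next
  assume f: "\<forall>B. \<exists>\<^sub>F n in sequentially. B < T (prefix \<omega> n)"
  show "unbounded_on T \<omega>"
  proof (rule ccontr)
    assume "\<not> unbounded_on T \<omega>"
    then have "limsup (\<lambda>n. ereal (T (prefix \<omega> n))) < \<infinity>" by (simp add: unbounded_on_def)
    then obtain B where "limsup (\<lambda>n. ereal (T (prefix \<omega> n))) < ereal B" by (metis ereal_dense2)
    then have "\<forall>\<^sub>F n in sequentially. ereal (T (prefix \<omega> n)) < ereal B" by (rule Limsup_lessD)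
    then have "\<not> (\<exists>\<^sub>F n in sequentially. B < T (prefix \<omega> n))"
      unfolding frequently_def not_not by (rule eventually_mono) simp
    with f show False by blast
  qed
qed

section \<open>Prefixes and the number of selected times\<close>

lemma length_prefix [simp]: "length (prefix \<omega> n) = n"
  by (simp add: prefix_def)

lemma prefix_Suc: "prefix \<omega> (Suc n) = prefix \<omega> n @ [\<omega> n]"
  by (simp add: prefix_def)

lemma prefix_0 [simp]: "prefix \<omega> 0 = []"
  by (simp add: prefix_def)

lemma sel_count_length: "sel_count (\<lambda>s. sel (length s)) \<omega> n = (\<Sum>k<n. of_bool (sel k))"
  by (simp add: sel_count_def)

lemma count_at_top:
  assumes "infinite {k. sel k}"
  shows "filterlim (\<lambda>n. \<Sum>k<n. of_bool (sel k) :: real) at_top sequentially"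
  unfolding filterlim_at_top
proof
  fix Z :: real
  obtain F where F: "finite F" "F \<subseteq> {k. sel k}" "card F = nat \<lceil>Z\<rceil>"
    using infinite_arbitrarily_large[OF assms, of "nat \<lceil>Z\<rceil>"] by blast
  obtain N where N: "F \<subseteq> {..<N}" using finite_nat_bounded[OF F(1)] by blast
  have "Z \<le> (\<Sum>k<n. of_bool (sel k) :: real)" if "n \<ge> N" for n
  proof -
    have "F \<subseteq> {..<n} \<inter> {k. sel k}" using N F(2) that by auto
    then have "card F \<le> card ({..<n} \<inter> {k. sel k})" by (intro card_mono) auto
    moreover have "(\<Sum>k<n. of_bool (sel k) :: real) = real (card ({..<n} \<inter> {k. sel k}))"
      by (simp add: of_bool_def sum.If_cases)
    ultimately show ?thesis using F(3) by linarith
  qed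
  then show "\<forall>\<^sub>F n in sequentially. Z \<le> (\<Sum>k<n. of_bool (sel k))"
    by (auto simp: eventually_sequentially)
qed

text \<open>One bound for four notions. A capital that reaches the diverging count infinitely often
  is unbounded, which contradicts the ML, wML and C notions; since the count is itself a computable
  growth function, it contradicts the S notion too.\<close>

lemma random_bet_bound:
  assumes R: "R \<in> {R_ML, R_wML, R_C, R_S}" and "R_random R \<phi> \<omega>"
    and sel: "recursive_fun (\<lambda>k. of_bool (sel k))" "infinite {k. sel k}"
    and uv: "u \<in> \<rat>" "v \<in> \<rat>" "0 \<le> u" "0 \<le> v"
    and T: "test_supermartingale \<phi> (mult_gen (bet sel u v))"
  shows "\<forall>\<^sub>F n in sequentially. mult_gen (bet sel u v) (prefix \<omega> n) < (\<Sum>k<n. of_bool (sel k))"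
proof (rule ccontr)
  let ?T = "mult_gen (bet sel u v)"
  define \<tau> :: "nat \<Rightarrow> real" where "\<tau> n = (\<Sum>k<n. of_bool (sel k))" for n
  note comp = bet_computable[OF sel(1) uv]
  have top: "filterlim \<tau> at_top sequentially" unfolding \<tau>_def by (rule count_at_top[OF sel(2)])
  assume "\<not> ?thesis"
  then have freq: "\<exists>\<^sub>F n in sequentially. \<tau> n \<le> ?T (prefix \<omega> n)"
    by (simp add: frequently_def \<tau>_def not_le)
  have unb: "unbounded_on ?T \<omega>"
    unfolding unbounded_on_iff
  proof
    fix B
    have "\<forall>\<^sub>F n in sequentially. B < \<tau> n" using top by (simp add: filterlim_at_top_dense)
    from frequently_eventually_conj[OF freq this] show "\<exists>\<^sub>F n in sequentially. B < ?T (prefix \<omega> n)"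
      by (rule frequently_elim1) simp
  qed
  have "limsup (\<lambda>n. ereal (?T (prefix \<omega> n) - \<tau> n)) \<ge> 0"
  proof (rule ccontr)
    assume "\<not> ?thesis"
    then have "\<forall>\<^sub>F n in sequentially. ereal (?T (prefix \<omega> n) - \<tau> n) < 0"
      by (intro Limsup_lessD) simp
    then have "\<not> (\<exists>\<^sub>F n in sequentially. \<tau> n \<le> ?T (prefix \<omega> n))"
      unfolding frequently_def not_not by (rule eventually_mono) (simp add: zero_ereal_def)
    with freq show False by blast
  qed
  moreover have "computable_map (\<lambda>n. n) \<tau>" unfolding \<tau>_def by (rule count_computable[OF sel(1)])
  moreover have "\<forall>n. \<tau> n \<ge> 0" by (simp add: \<tau>_def sum_nonneg)
  moreover have "mono \<tau>" unfolding \<tau>_def by (intro monoI sum_mono2) auto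
  moreover have "\<not> bdd_above (range \<tau>)"
  proof
    assume "bdd_above (range \<tau>)"
    then obtain B where B: "\<And>n. \<tau> n \<le> B" by (auto simp: bdd_above_def)
    have "\<forall>\<^sub>F n in sequentially. B < \<tau> n" using top by (simp add: filterlim_at_top_dense)
    then obtain n where "B < \<tau> n" by (auto simp: eventually_sequentially)
    with B[of n] show False by simp
  qed
  ultimately have "\<not> S_random \<phi> \<omega>" using comp T unfolding S_random_def not_not
    by (intro exI[of _ ?T] exI[of _ \<tau>] conjI)
  moreover have "\<not> MLrand \<phi> \<omega>" "\<not> wMLrand \<phi> \<omega>" "\<not> C_random \<phi> \<omega>"
    using comp T unb unfolding MLrand_def wMLrand_def C_random_def by blast+
  ultimately show False using assms(1,2) by auto
qed

section \<open>Frequency conditions without limits or quotients\<close>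

lemma liminf_ge_0_iff:
  "liminf (\<lambda>n. ereal (f n)) \<ge> 0 \<longleftrightarrow> (\<forall>e>0. \<forall>\<^sub>F n in sequentially. - e < f n)"
proof
  assume l: "liminf (\<lambda>n. ereal (f n)) \<ge> 0"
  show "\<forall>e>0. \<forall>\<^sub>F n in sequentially. - e < f n"
  proof (intro allI impI)
    fix e :: real assume "e > 0"
    then have "ereal (- e) < 0" by simp
    then have "\<forall>\<^sub>F n in sequentially. ereal (- e) < ereal (f n)"
      using l unfolding le_Liminf_iff by blast
    then show "\<forall>\<^sub>F n in sequentially. - e < f n" by simp
  qed
next
  assume e: "\<forall>e>0. \<forall>\<^sub>F n in sequentially. - e < f n"
  show "liminf (\<lambda>n. ereal (f n)) \<ge> 0"
    unfolding le_Liminf_iff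
  proof (intro allI impI)
    fix y :: ereal assume "y < 0"
    then obtain r where r: "y < ereal r" "ereal r < 0" using ereal_dense2 by blast
    then have "\<forall>\<^sub>F n in sequentially. - (- r) < f n" using e
      by (metis ereal_less(2) less_ereal.simps(1) neg_0_less_iff_less zero_ereal_def)
    then show "\<forall>\<^sub>F n in sequentially. y < ereal (f n)"
      by (rule eventually_mono) (use r(1) in \<open>auto intro: less_trans\<close>)
  qed
qed

lemma limsup_le_0_iff:
  "limsup (\<lambda>n. ereal (f n)) \<le> 0 \<longleftrightarrow> (\<forall>e>0. \<forall>\<^sub>F n in sequentially. f n < e)"
proof -
  have "limsup (\<lambda>n. ereal (f n)) = - liminf (\<lambda>n. ereal (- f n))"
    using ereal_Liminf_uminus[of sequentially "\<lambda>n. ereal (f n)"] by simp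
  then show ?thesis using liminf_ge_0_iff[of "\<lambda>n. - f n"] by simp
qed

text \<open>The count is eventually positive, so the denominators can be cleared; early quotients by
  0 do not matter.\<close>

lemma CH_condition_iff:
  assumes "filterlim (sel_count S \<omega>) at_top sequentially"
  shows "CH_condition \<phi> \<omega> S \<longleftrightarrow> (\<forall>e>0.
      (\<forall>\<^sub>F n in sequentially. - e * sel_count S \<omega> n
        < (\<Sum>k<n. of_bool (S (prefix \<omega> k)) * (of_bool (\<omega> k) - flo \<phi> (prefix \<omega> k)))) \<and>
      (\<forall>\<^sub>F n in sequentially. (\<Sum>k<n. of_bool (S (prefix \<omega> k)) * (of_bool (\<omega> k) - fhi \<phi> (prefix \<omega> k)))
        < e * sel_count S \<omega> n))"
proof -
  have pos: "\<forall>\<^sub>F n in sequentially. 0 < sel_count S \<omega> n"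
    using assms by (simp add: filterlim_at_top_dense)
  have "(\<forall>\<^sub>F n in sequentially. - e < f n / sel_count S \<omega> n)
      = (\<forall>\<^sub>F n in sequentially. - e * sel_count S \<omega> n < f n)" for f e
    by (rule eventually_cong[OF pos]) (simp add: field_simps)
  moreover have "(\<forall>\<^sub>F n in sequentially. f n / sel_count S \<omega> n < e)
      = (\<forall>\<^sub>F n in sequentially. f n < e * sel_count S \<omega> n)" for f e
    by (rule eventually_cong[OF pos]) (simp add: field_simps)
  ultimately show ?thesis
    unfolding CH_condition_def liminf_ge_0_iff limsup_le_0_iff using assms by auto
qed

text \<open>\<open>m / sqrt x ^ m\<close> tends to 0; squaring gives the claim. It will be applied
  with \<open>m\<close> the number of selected times, a bound for each of two capitals whose product
  grows exponentially.\<close>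

lemma eventually_square_less_power:
  fixes x :: real
  assumes "1 < x"
  shows "\<forall>\<^sub>F m in sequentially. real m ^ 2 < x ^ m"
proof -
  have "(\<lambda>m. real m * (1 / sqrt x) ^ m) \<longlonglongrightarrow> 0"
    using assms by (intro powser_times_n_limit_0) auto
  then have "\<forall>\<^sub>F m in sequentially. real m * (1 / sqrt x) ^ m < 1"
    by (rule order_tendstoD) simp
  then show ?thesis
  proof eventually_elim
    case (elim m)
    then have "real m < sqrt x ^ m" using assms by (simp add: power_divide divide_less_eq)
    then have "real m ^ 2 < (sqrt x ^ m) ^ 2" by (intro power_strict_mono) auto
    also have "\<dots> = x ^ m" using assms
      by (metis less_eq_real_def less_trans mult.commute power_mult real_sqrt_pow2 zero_less_one)
    finally show ?case .
  qed
qed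

text \<open>Both systems are arbitrary, so that the constant interval can take the role of
  \<open>\<phi>\<close> as well as that of \<open>\<psi>\<close>.\<close>

lemma not_random_for_separated:
  fixes lo hi :: real
  assumes fs: "forecasting_system \<phi>" "forecasting_system \<psi>"
    and sel: "recursive_fun (\<lambda>k. of_bool (sel k))" "infinite {k. sel k}"
    and rat: "lo \<in> \<rat>" "hi \<in> \<rat>" and lohi: "0 \<le> lo" "lo < hi" "hi \<le> 1"
    and lo: "\<And>s. sel (length s) \<Longrightarrow> fhi \<phi> s \<le> lo"
    and hi: "\<And>s. sel (length s) \<Longrightarrow> hi \<le> flo \<psi> s"
    and rand: "R_random R \<phi> \<omega>" "R_random R \<psi> \<omega>"
  shows False
proof (cases "R \<in> {R_CH, R_wCH}")
  case True
  let ?S = "\<lambda>s. sel (length s)"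
  let ?c = "\<lambda>n. \<Sum>k<n. of_bool (sel k) :: real"
  have top: "filterlim (sel_count ?S \<omega>) at_top sequentially"
    unfolding sel_count_length[abs_def] by (rule count_at_top[OF sel(2)])
  have "recursive_sel ?S" "temporal_sel ?S"
    using recursive_sel_length[OF sel(1)] by (auto simp: temporal_sel_def)
  then have CH: "CH_condition \<phi> \<omega> ?S" "CH_condition \<psi> \<omega> ?S"
    using rand True by (auto simp: CH_random_def wCH_random_def)
  \<comment> \<open>Half the gap: the two frequency conditions force the difference of the sums
    strictly below \<open>2 * e\<close> times the count, whereas it is at least that.\<close>
  define e where "e = (hi - lo) / 2"
  have "e > 0" using lohi by (simp add: e_def)
  have "\<forall>\<^sub>F n in sequentially. - e * ?c n < (\<Sum>k<n. of_bool (sel k) * (of_bool (\<omega> k) - flo \<psi> (prefix \<omega> k)))"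
    using CH(2)[unfolded CH_condition_iff[OF top]] \<open>e > 0\<close> by (simp add: sel_count_length)
  moreover have "\<forall>\<^sub>F n in sequentially. (\<Sum>k<n. of_bool (sel k) * (of_bool (\<omega> k) - fhi \<phi> (prefix \<omega> k))) < e * ?c n"
    using CH(1)[unfolded CH_condition_iff[OF top]] \<open>e > 0\<close> by (simp add: sel_count_length)
  ultimately have "\<forall>\<^sub>F n in sequentially. False"
  proof eventually_elim
    case (elim n)
    have "(\<Sum>k<n. of_bool (sel k) * (of_bool (\<omega> k) - flo \<psi> (prefix \<omega> k)))
        \<le> (\<Sum>k<n. of_bool (sel k) * (of_bool (\<omega> k) - hi))"
      by (intro sum_mono) (auto simp: hi)
    moreover have "(\<Sum>k<n. of_bool (sel k) * (of_bool (\<omega> k) - lo))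
        \<le> (\<Sum>k<n. of_bool (sel k) * (of_bool (\<omega> k) - fhi \<phi> (prefix \<omega> k)))"
      by (intro sum_mono) (auto simp: lo)
    moreover have "(\<Sum>k<n. of_bool (sel k) * (of_bool (\<omega> k) - lo))
        - (\<Sum>k<n. of_bool (sel k) * (of_bool (\<omega> k) - hi)) = 2 * e * ?c n"
      unfolding sum_subtractf[symmetric] sum_distrib_left
      by (intro sum.cong) (auto simp: algebra_simps e_def)
    ultimately show False using elim by linarith
  qed
  then show False by simp
next
  case False
  then have R: "R \<in> {R_ML, R_wML, R_C, R_S}" by (cases R) auto
  define c where "c = (hi - lo) / 2"
  \<comment> \<open>On outcome \<open>x\<close> the factors are \<open>1 + c * (x - lo)\<close>
    against \<open>\<phi>\<close> and \<open>1 - c * (x - hi)\<close> against \<open>\<psi>\<close>.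
    Their expectations are at most 1 for \<open>p \<le> lo\<close> and \<open>hi \<le> p\<close>
    respectively.\<close>
  define u1 v1 u2 v2 where "u1 = 1 + c * (1 - lo)" and "v1 = 1 - c * lo"
    and "u2 = 1 - c * (1 - hi)" and "v2 = 1 + c * hi"
  have c: "0 < c" "c \<le> 1" "c \<in> \<rat>" using lohi rat by (auto simp: c_def)
  have Q: "u1 \<in> \<rat>" "v1 \<in> \<rat>" "u2 \<in> \<rat>" "v2 \<in> \<rat>"
    unfolding u1_def v1_def u2_def v2_def using c(3) rat by auto
  have "c * lo \<le> 1" "c * (1 - hi) \<le> 1" using c lohi by (auto intro!: mult_le_one)
  then have nn: "0 \<le> u1" "0 \<le> v1" "0 \<le> u2" "0 \<le> v2"
    unfolding u1_def v1_def u2_def v2_def using c lohi by (auto intro!: add_nonneg_nonneg mult_nonneg_nonneg)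
  have "p * u1 + (1 - p) * v1 = 1 + c * (p - lo)" "p * u2 + (1 - p) * v2 = 1 - c * (p - hi)" for p
    unfolding u1_def v1_def u2_def v2_def by (simp_all add: algebra_simps)
  moreover have "p \<le> lo" if "sel (length s)" "p \<in> \<phi> s" for p s
    using lo[OF that(1)] that(2) flo_le_fhi_bounds(4)[OF fs(1), of s] by auto
  moreover have "hi \<le> p" if "sel (length s)" "p \<in> \<psi> s" for p s
    using hi[OF that(1)] that(2) flo_le_fhi_bounds(4)[OF fs(2), of s] by auto
  ultimately have T: "test_supermartingale \<phi> (mult_gen (bet sel u1 v1))"
      "test_supermartingale \<psi> (mult_gen (bet sel u2 v2))"
    using c by (auto intro!: bet_test_supermartingale fs nn simp: mult_le_0_iff)

  define cnt where "cnt n = (\<Sum>k<n. of_bool (sel k) :: nat)" for n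
  have cnt: "real (cnt n) = (\<Sum>k<n. of_bool (sel k))" for n by (simp add: cnt_def)
  have hilo: "hi - lo = 2 * c" by (simp add: c_def)
  \<comment> \<open>The linear gain \<open>c * (hi - lo)\<close> equals \<open>2 * c\<^sup>2\<close>
    by the choice of \<open>c\<close>, and the quadratic loss is at most
    \<open>c\<^sup>2\<close>.\<close>
  have "u1 * u2 = 1 + c * (hi - lo) - c\<^sup>2 * ((1 - lo) * (1 - hi))"
      "v1 * v2 = 1 + c * (hi - lo) - c\<^sup>2 * (lo * hi)"
    unfolding u1_def v1_def u2_def v2_def by (simp_all add: algebra_simps power2_eq_square)
  moreover have "c\<^sup>2 * ((1 - lo) * (1 - hi)) \<le> c\<^sup>2 * 1" "c\<^sup>2 * (lo * hi) \<le> c\<^sup>2 * 1"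
    using lohi by (intro mult_left_mono mult_le_one; simp)+
  ultimately have prod: "1 + c\<^sup>2 \<le> u1 * u2" "1 + c\<^sup>2 \<le> v1 * v2"
    unfolding hilo by (simp_all add: power2_eq_square)
  have growth: "(1 + c\<^sup>2) ^ cnt n
      \<le> mult_gen (bet sel u1 v1) (prefix \<omega> n) * mult_gen (bet sel u2 v2) (prefix \<omega> n)" for n
  proof (induction n)
    case 0
    then show ?case by (simp add: cnt_def)
  next
    case (Suc n)
    let ?D = "bet sel u1 v1 (prefix \<omega> n) (\<omega> n) * bet sel u2 v2 (prefix \<omega> n) (\<omega> n)"
    have "(1 + c\<^sup>2) ^ of_bool (sel n) \<le> ?D"
      using prod by (simp add: bet_def)
    then have "(1 + c\<^sup>2) ^ cnt n * (1 + c\<^sup>2) ^ of_bool (sel n)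
        \<le> mult_gen (bet sel u1 v1) (prefix \<omega> n) * mult_gen (bet sel u2 v2) (prefix \<omega> n) * ?D"
      by (intro mult_mono Suc.IH) (auto intro!: mult_nonneg_nonneg mult_gen_bet_nonneg nn)
    then show ?case by (simp add: prefix_Suc cnt_def power_add mult_ac)
  qed
  have "filterlim (\<lambda>n. real (cnt n)) at_top sequentially"
    using count_at_top[OF sel(2)] by (simp add: cnt)
  then have "filterlim cnt at_top sequentially"
    by (simp add: filterlim_sequentially_iff_filterlim_real)
  moreover have "\<forall>\<^sub>F m in sequentially. real m ^ 2 < (1 + c\<^sup>2) ^ m"
    using c(1) by (intro eventually_square_less_power) simp
  ultimately have "\<forall>\<^sub>F n in sequentially. real (cnt n) ^ 2 < (1 + c\<^sup>2) ^ cnt n"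
    by (rule eventually_compose_filterlim[rotated])
  moreover note random_bet_bound[OF R rand(1) sel Q(1,2) nn(1,2) T(1)]
    random_bet_bound[OF R rand(2) sel Q(3,4) nn(3,4) T(2)]
  ultimately have "\<forall>\<^sub>F n in sequentially. False"
  proof eventually_elim
    case (elim n)
    \<comment> \<open>Both capitals are below the count, so their product is at most its square,
      which the exponential lower bound exceeds.\<close>
    have "mult_gen (bet sel u1 v1) (prefix \<omega> n) * mult_gen (bet sel u2 v2) (prefix \<omega> n)
        \<le> real (cnt n) * real (cnt n)"
      using elim unfolding cnt by (intro mult_mono) (auto intro!: mult_gen_bet_nonneg nn sum_nonneg)
    then show False using growth[of n] elim(1) by (simp add: power2_eq_square)
  qed
  then show False by simp
qed

section \<open>Eventually wider forecasts\<close>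

lemma finite_length_le: "finite {s :: bool list. length s \<le> n}"
  using finite_lists_length_le[of "UNIV :: bool set" n] by simp

text \<open>Keep capital 1 up to time \<open>N\<close> and then follow \<open>T\<close> scaled down.
  The passage at time \<open>N\<close> respects the supermartingale inequality because
  \<open>c\<close> bounds \<open>T\<close> on all situations of length at most
  \<open>N\<close>.\<close>

lemma test_supermartingale_restart:
  assumes fs: "forecasting_system \<phi>" "forecasting_system \<psi>"
    and sub: "\<And>s. N \<le> length s \<Longrightarrow> \<phi> s \<subseteq> \<psi> s"
    and T: "test_supermartingale \<psi> T"
  obtains c :: nat where "c > 0"
    "test_supermartingale \<phi> (\<lambda>s. if length s \<le> N then 1 else T s / real c)"
proof -
  have nn: "0 \<le> T s" for s using T by (simp add: test_supermartingale_def)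
  have sup: "p * T (s @ [True]) + (1 - p) * T (s @ [False]) \<le> T s" if "p \<in> \<psi> s" for p s
    using T that by (simp add: test_supermartingale_def supermartingale_iff[OF fs(2)])
  \<comment> \<open>The sum dominates each of its nonnegative terms. Rounding up to a natural number
    keeps division by \<open>c\<close> a simple operation on codes, and \<open>Suc\<close> makes it
    positive.\<close>
  define c where "c = Suc (nat \<lceil>\<Sum>s | length s \<le> N. T s\<rceil>)"
  have c: "T s \<le> real c" if "length s \<le> N" for s
  proof -
    have "T s \<le> (\<Sum>s | length s \<le> N. T s)"
      by (rule member_le_sum) (use that nn finite_length_le in auto)
    then show ?thesis unfolding c_def by linarith
  qed
  let ?T = "\<lambda>s. if length s \<le> N then 1 else T s / real c"
  have "p * ?T (s @ [True]) + (1 - p) * ?T (s @ [False]) \<le> ?T s" if p: "p \<in> \<phi> s" for p s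
  proof (cases "length s < N")
    case False
    then have "p \<in> \<psi> s" using sub[of s] p by auto
    then have "(p * T (s @ [True]) + (1 - p) * T (s @ [False])) / real c \<le> T s / real c"
      by (intro divide_right_mono sup) simp_all
    moreover have "T s / real c \<le> ?T s" using c[of s] by (simp add: c_def divide_le_eq)
    ultimately show ?thesis using False by (simp add: add_divide_distrib)
  qed simp
  then have "test_supermartingale \<phi> ?T"
    by (simp add: test_supermartingale_def supermartingale_iff[OF fs(1)] nn)
  then show thesis by (intro that[of c]) (simp_all add: c_def)
qed

lemma unbounded_on_eventually_divide:
  assumes "unbounded_on T \<omega>" "c > 0" "\<And>n. n > N \<Longrightarrow> T' (prefix \<omega> n) = T (prefix \<omega> n) / c"
  shows "unbounded_on T' \<omega>"
  unfolding unbounded_on_iff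
proof
  fix B
  have "\<exists>\<^sub>F n in sequentially. B * c < T (prefix \<omega> n)"
    using assms(1) by (simp add: unbounded_on_iff)
  from frequently_eventually_conj[OF this eventually_gt_at_top[of N]]
  show "\<exists>\<^sub>F n in sequentially. B < T' (prefix \<omega> n)"
    by (rule frequently_elim1) (use assms(2,3) in \<open>auto simp: less_divide_eq\<close>)
qed

text \<open>A multiplier process is unconstrained where the process it generates vanishes, so setting it to 1
  before time \<open>N\<close> need not leave a supermartingale. Betting everything on \<open>\<omega>\<close> during the first \<open>N\<close>
  steps does: the new process vanishes off the cone of \<open>prefix \<omega> N\<close> and is a constant multiple of
  the old one on it.\<close>

lemma mult_gen_restart:
  fixes D :: "bool list \<Rightarrow> bool \<Rightarrow> real"
  assumes fs: "forecasting_system \<phi>" "forecasting_system \<psi>"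
    and sub: "\<And>s. N \<le> length s \<Longrightarrow> \<phi> s \<subseteq> \<psi> s"
    and T: "test_supermartingale \<psi> (mult_gen D)" and unb: "unbounded_on (mult_gen D) \<omega>"
  defines "D' \<equiv> \<lambda>s x. if length s < N then of_bool (x = \<omega> (length s)) else D s x"
  shows "test_supermartingale \<phi> (mult_gen D')" "unbounded_on (mult_gen D') \<omega>"
proof -
  define K where "K = mult_gen D (prefix \<omega> N)"
  have nn: "0 \<le> mult_gen D s" for s using T by (simp add: test_supermartingale_def)
  have sup: "p * mult_gen D (s @ [True]) + (1 - p) * mult_gen D (s @ [False]) \<le> mult_gen D s"
    if "p \<in> \<psi> s" for p s
    using T that by (simp only: test_supermartingale_def supermartingale_iff[OF fs(2)])
  have init: "mult_gen D' s = of_bool (s = prefix \<omega> (length s))" if "length s \<le> N" for s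
    using that by (induction s rule: rev_induct) (auto simp: D'_def prefix_Suc)
  \<comment> \<open>Stated without division by \<open>K\<close>, since \<open>K \<noteq> 0\<close>
    is derived from this identity: otherwise the old process would vanish along
    \<open>\<omega>\<close> from time \<open>N\<close> on.\<close>
  have later: "mult_gen D' s * K = (if take N s = prefix \<omega> N then mult_gen D s else 0)"
    if "N \<le> length s" for s
    using that
  proof (induction s rule: rev_induct)
    case Nil
    then show ?case by (simp add: K_def)
  next
    case (snoc x s)
    show ?case
    proof (cases "length (s @ [x]) = N")
      case True
      then show ?thesis using init[of "s @ [x]"] by (auto simp del: mult_gen_snoc simp: K_def)
    next
      case False
      then show ?thesis using snoc by (auto simp: D'_def)
    qed
  qed
  have take: "take N (prefix \<omega> n) = prefix \<omega> N" if "n \<ge> N" for n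
    using that by (simp add: prefix_def take_map)
  have "K \<noteq> 0"
  proof
    assume "K = 0"
    then have "mult_gen D (prefix \<omega> n) = 0" if "n \<ge> N" for n
      using later[of "prefix \<omega> n"] take[OF that] that by simp
    then have "\<forall>\<^sub>F n in sequentially. \<not> 0 < mult_gen D (prefix \<omega> n)"
      by (intro eventually_mono[OF eventually_ge_at_top[of N]]) simp
    moreover have "\<exists>\<^sub>F n in sequentially. 0 < mult_gen D (prefix \<omega> n)"
      using unb by (simp add: unbounded_on_iff)
    ultimately show False by (simp add: frequently_def)
  qed
  then have "K > 0" using nn[of "prefix \<omega> N"] by (simp add: K_def)
  have later': "mult_gen D' s = (if take N s = prefix \<omega> N then mult_gen D s / K else 0)"
    if "N \<le> length s" for s
    using later[OF that] \<open>K > 0\<close> by (auto simp: field_simps split: if_splits)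
  show "unbounded_on (mult_gen D') \<omega>"
    by (rule unbounded_on_eventually_divide[OF unb \<open>K > 0\<close>, of N]) (simp add: later' take)
  have nn': "0 \<le> mult_gen D' s" for s
    by (cases "length s \<le> N") (use nn \<open>K > 0\<close> in \<open>auto simp: init later'\<close>)
  have "p * mult_gen D' (s @ [True]) + (1 - p) * mult_gen D' (s @ [False]) \<le> mult_gen D' s"
    if p: "p \<in> \<phi> s" for p s
  proof (cases "length s < N")
    case True
    \<comment> \<open>Before time \<open>N\<close> one successor keeps the current capital and the
      other gets 0, so the expectation is the capital times \<open>p\<close> or
      \<open>1 - p\<close>.\<close>
    have "0 \<le> p" "p \<le> 1" using p fs(1) is_iforecastD(2) by (force simp: forecasting_system_def)+
    then have "mult_gen D' s * p \<le> mult_gen D' s" "mult_gen D' s * (1 - p) \<le> mult_gen D' s"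
      by (intro mult_left_le nn'; simp)+
    then show ?thesis using True by (simp add: D'_def mult_ac)
  next
    case False
    then have "p \<in> \<psi> s" using sub[of s] p by auto
    then have "(p * mult_gen D (s @ [True]) + (1 - p) * mult_gen D (s @ [False])) / K \<le> mult_gen D s / K"
      using \<open>K > 0\<close> by (intro divide_right_mono sup) simp_all
    then show ?thesis using False
      by (simp del: mult_gen_snoc add: later' add_divide_distrib)
  qed
  then show "test_supermartingale \<phi> (mult_gen D')"
    by (simp add: test_supermartingale_def supermartingale_iff[OF fs(1)] nn' del: mult_gen_snoc)
qed

text \<open>Only the terms with \<open>k < N\<close> can violate the comparison, each by at most 1;
  the loss is therefore bounded independently of \<open>n\<close>.\<close>

lemma sum_le_eventually_le:
  fixes x y :: "nat \<Rightarrow> real"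
  assumes "\<And>k. k \<ge> N \<Longrightarrow> x k \<le> y k" "\<And>k. x k \<le> y k + 1"
  shows "(\<Sum>k<n. x k) \<le> (\<Sum>k<n. y k) + real N"
proof -
  have "(\<Sum>k<n. x k) \<le> (\<Sum>k<n. y k + of_bool (k < N))"
    using assms by (intro sum_mono) (auto simp: not_less of_bool_def)
  also have "\<dots> = (\<Sum>k<n. y k) + real (card ({..<n} \<inter> {k. k < N}))"
    by (simp add: sum.distrib)
  also have "card ({..<n} \<inter> {k. k < N}) \<le> card {..<N}" by (intro card_mono) auto
  finally show ?thesis by simp
qed

text \<open>The sums worsen by at most \<open>N\<close>, which is negligible relative to the
  diverging count: one half of \<open>e\<close> absorbs this shift, the other half comes from the
  condition for \<open>\<phi>\<close>.\<close>

lemma CH_condition_eventually_wider: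
  assumes fs: "forecasting_system \<phi>" "forecasting_system \<psi>"
    and sub: "\<And>s. N \<le> length s \<Longrightarrow> \<phi> s \<subseteq> \<psi> s"
    and CH: "CH_condition \<phi> \<omega> S"
  shows "CH_condition \<psi> \<omega> S"
proof (cases "filterlim (sel_count S \<omega>) at_top sequentially")
  case True
  have le: "flo \<psi> s \<le> flo \<phi> s" "fhi \<phi> s \<le> fhi \<psi> s" if "N \<le> length s" for s
    using sub[OF that] flo_le_fhi_bounds[OF fs(1), of s] flo_le_fhi_bounds[OF fs(2), of s] by auto
  let ?lo = "\<lambda>\<phi> n. \<Sum>k<n. of_bool (S (prefix \<omega> k)) * (of_bool (\<omega> k) - flo \<phi> (prefix \<omega> k))"
  let ?hi = "\<lambda>\<phi> n. \<Sum>k<n. of_bool (S (prefix \<omega> k)) * (of_bool (\<omega> k) - fhi \<phi> (prefix \<omega> k))"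
  have le1: "flo \<psi> s \<le> flo \<phi> s + 1" "fhi \<phi> s \<le> fhi \<psi> s + 1" for s
    using flo_le_fhi_bounds[OF fs(1), of s] flo_le_fhi_bounds[OF fs(2), of s] by linarith+
  have lo: "?lo \<phi> n \<le> ?lo \<psi> n + real N" for n
    by (rule sum_le_eventually_le) (use le(1) le1(1) in \<open>auto simp: algebra_simps\<close>)
  have hi: "?hi \<psi> n \<le> ?hi \<phi> n + real N" for n
    by (rule sum_le_eventually_le) (use le(2) le1(2) in \<open>auto simp: algebra_simps\<close>)
  show ?thesis
    unfolding CH_condition_iff[OF True]
  proof (intro allI impI conjI)
    fix e :: real assume e: "e > 0"
    have "\<forall>\<^sub>F n in sequentially. real N / (e / 2) < sel_count S \<omega> n"
      using True by (simp add: filterlim_at_top_dense)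
    then have N: "\<forall>\<^sub>F n in sequentially. real N < e / 2 * sel_count S \<omega> n"
      by (rule eventually_mono) (use e in \<open>simp add: field_simps\<close>)
    have "\<forall>\<^sub>F n in sequentially. - (e / 2) * sel_count S \<omega> n < ?lo \<phi> n"
      "\<forall>\<^sub>F n in sequentially. ?hi \<phi> n < e / 2 * sel_count S \<omega> n"
      using CH[unfolded CH_condition_iff[OF True], rule_format, of "e / 2"] e by simp_all
    with N have "\<forall>\<^sub>F n in sequentially. - e * sel_count S \<omega> n < ?lo \<psi> n \<and>
        ?hi \<psi> n < e * sel_count S \<omega> n"
    proof eventually_elim
      case (elim n)
      have "e / 2 * sel_count S \<omega> n + e / 2 * sel_count S \<omega> n = e * sel_count S \<omega> n" by simp
      then show ?case using elim lo[of n] hi[of n] unfolding mult_minus_left by linarith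
    qed
    then show "\<forall>\<^sub>F n in sequentially. - e * sel_count S \<omega> n < ?lo \<psi> n"
      "\<forall>\<^sub>F n in sequentially. ?hi \<psi> n < e * sel_count S \<omega> n"
      by (auto elim: eventually_mono)
  qed
qed (simp add: CH_condition_def)

text \<open>The martingale notions are treated by contraposition: a test that refutes randomness for
  \<open>\<psi>\<close> is restarted after time \<open>N\<close> as a test for
  \<open>\<phi>\<close>. Scaling and finitely many changes preserve effectiveness.\<close>

lemma random_eventually_wider:
  assumes fs: "forecasting_system \<phi>" "forecasting_system \<psi>"
    and sub: "\<And>s. N \<le> length s \<Longrightarrow> \<phi> s \<subseteq> \<psi> s"
    and rand: "R_random R \<phi> \<omega>"
  shows "R_random R \<psi> \<omega>"
proof -
  let ?A = "{s :: bool list. length s \<le> N}"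
  have cut_lsc: "lsc_map sit_code (\<lambda>s. if length s \<le> N then 1 else T s)"
    if "lsc_map sit_code T" for T
    using finite_modification[of "lsc_map sit_code" ?A T "\<lambda>_. 1",
        OF lsc_map_update[OF _ inj_sit_code] finite_length_le that]
    by (simp only: of_nat_1 mem_Collect_eq)
  have cut_comp: "computable_map sit_code (\<lambda>s. if length s \<le> N then 1 else T s)"
    if "computable_map sit_code T" for T
    using finite_modification[of "computable_map sit_code" ?A T "\<lambda>_. 1",
        OF computable_map_update[OF _ inj_sit_code] finite_length_le that]
    by (simp only: of_nat_1 mem_Collect_eq)
  have ml: "\<not> MLrand \<phi> \<omega>"
    if T: "lsc_map sit_code T" "test_supermartingale \<psi> T" "unbounded_on T \<omega>" for T
  proof -
    obtain c :: nat where c: "c > 0"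
      "test_supermartingale \<phi> (\<lambda>s. if length s \<le> N then 1 else T s / real c)"
      using test_supermartingale_restart[OF fs sub T(2)] by blast
    moreover have "lsc_map sit_code (\<lambda>s. if length s \<le> N then 1 else T s / real c)"
      by (intro cut_lsc lsc_map_divide T c)
    moreover have "unbounded_on (\<lambda>s. if length s \<le> N then 1 else T s / real c) \<omega>"
      by (rule unbounded_on_eventually_divide[OF T(3), of "real c" N]) (use c in auto)
    ultimately show ?thesis unfolding MLrand_def by blast
  qed
  have C: "\<not> C_random \<phi> \<omega>"
    if T: "computable_map sit_code T" "test_supermartingale \<psi> T" "unbounded_on T \<omega>" for T
  proof -
    obtain c :: nat where c: "c > 0"
      "test_supermartingale \<phi> (\<lambda>s. if length s \<le> N then 1 else T s / real c)"
      using test_supermartingale_restart[OF fs sub T(2)] by blast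
    moreover have "computable_map sit_code (\<lambda>s. if length s \<le> N then 1 else T s / real c)"
      by (intro cut_comp computable_map_divide T c)
    moreover have "unbounded_on (\<lambda>s. if length s \<le> N then 1 else T s / real c) \<omega>"
      by (rule unbounded_on_eventually_divide[OF T(3), of "real c" N]) (use c in auto)
    ultimately show ?thesis unfolding C_random_def by blast
  qed
  have S: "\<not> S_random \<phi> \<omega>"
    if T: "computable_map sit_code T" "test_supermartingale \<psi> T"
      and \<tau>: "computable_map (\<lambda>n. n) \<tau>" "\<forall>n. \<tau> n \<ge> 0" "mono \<tau>" "\<not> bdd_above (range \<tau>)"
      and lim: "limsup (\<lambda>n. ereal (T (prefix \<omega> n) - \<tau> n)) \<ge> 0" for T and \<tau> :: "nat \<Rightarrow> real"
  proof -
    obtain c :: nat where c: "c > 0"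
      "test_supermartingale \<phi> (\<lambda>s. if length s \<le> N then 1 else T s / real c)"
      using test_supermartingale_restart[OF fs sub T(2)] by blast
    \<comment> \<open>The growth function is divided by the same constant, so that after time
      \<open>N\<close> the difference is the old one divided by \<open>c\<close>.\<close>
    let ?T = "\<lambda>s. if length s \<le> N then 1 else T s / real c" and ?\<tau> = "\<lambda>n. \<tau> n / real c"
    have "computable_map sit_code ?T"
      by (intro cut_comp computable_map_divide T c)
    moreover note c(2)
    moreover have "computable_map (\<lambda>n. n) ?\<tau>" by (intro computable_map_divide \<tau> c)
    moreover have "\<forall>n. ?\<tau> n \<ge> 0" using \<tau>(2) by simp
    moreover have "mono ?\<tau>" using \<tau>(3) by (auto simp: mono_def divide_right_mono)
    moreover have "\<not> bdd_above (range ?\<tau>)"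
    proof
      assume "bdd_above (range ?\<tau>)"
      then obtain B where "\<And>n. \<tau> n / real c \<le> B" by (auto simp: bdd_above_def)
      then have "\<tau> n \<le> B * real c" for n using c(1) by (simp add: pos_divide_le_eq)
      then show False using \<tau>(4) by (auto simp: bdd_above_def)
    qed
    moreover have "limsup (\<lambda>n. ereal (?T (prefix \<omega> n) - ?\<tau> n)) \<ge> 0"
    proof (rule ccontr)
      assume "\<not> ?thesis"
      then have "limsup (\<lambda>n. ereal (?T (prefix \<omega> n) - ?\<tau> n)) < 0" by simp
      then obtain r where r: "limsup (\<lambda>n. ereal (?T (prefix \<omega> n) - ?\<tau> n)) < ereal r" "ereal r < 0"
        using ereal_dense2 by blast
      from Limsup_lessD[OF r(1)] eventually_gt_at_top[of N]
      have "\<forall>\<^sub>F n in sequentially. ereal (T (prefix \<omega> n) - \<tau> n) \<le> ereal (r * real c)"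
      proof eventually_elim
        case (elim n)
        then have "(T (prefix \<omega> n) - \<tau> n) / real c < r" by (simp add: diff_divide_distrib)
        then show ?case using c(1) by (simp add: pos_divide_less_eq)
      qed
      then have "limsup (\<lambda>n. ereal (T (prefix \<omega> n) - \<tau> n)) \<le> ereal (r * real c)"
        by (rule Limsup_bounded)
      with lim have "0 \<le> ereal (r * real c)" by (rule order_trans)
      then show False using r(2) c(1) by (auto simp: zero_le_mult_iff)
    qed
    ultimately show ?thesis unfolding S_random_def not_not
      by (intro exI[of _ ?T] exI[of _ ?\<tau>] conjI)
  qed
  have wml: "\<not> wMLrand \<phi> \<omega>"
    if D: "lsc_map sitx_code (\<lambda>(s, x). D s x)" "test_supermartingale \<psi> (mult_gen D)"
      "unbounded_on (mult_gen D) \<omega>" for D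
  proof -
    \<comment> \<open>Only the first \<open>N\<close> outcomes of \<open>\<omega>\<close> enter, a
      finite table, so \<open>D'\<close> remains lower semicomputable whatever the path.\<close>
    define D' where "D' s x = (if length s < N then of_bool (x = \<omega> (length s)) else D s x)" for s x
    let ?A = "{s :: bool list. length s < N} \<times> (UNIV :: bool set)"
    have "finite {s :: bool list. length s < N}"
      by (rule finite_subset[OF _ finite_length_le[of N]]) auto
    then have "finite ?A" by simp
    from finite_modification[of "lsc_map sitx_code", OF lsc_map_update[OF _ inj_sitx_code] this D(1)]
    have "lsc_map sitx_code (\<lambda>d. if d \<in> ?A then real ((\<lambda>(s, x). of_bool (x = \<omega> (length s))) d)
        else (\<lambda>(s, x). D s x) d)" .
    then have "lsc_map sitx_code (\<lambda>(s, x). D' s x)"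
      by (rule back_subst[of "lsc_map sitx_code"]) (auto simp: D'_def)
    moreover have "test_supermartingale \<phi> (mult_gen D')" "unbounded_on (mult_gen D') \<omega>"
      using mult_gen_restart[OF fs sub D(2,3)] unfolding D'_def[abs_def] by blast+
    ultimately show ?thesis unfolding wMLrand_def by blast
  qed
  have CH: "CH_condition \<phi> \<omega> S \<Longrightarrow> CH_condition \<psi> \<omega> S" for S
    by (rule CH_condition_eventually_wider[OF fs sub])
  show ?thesis
  proof (cases R)
    case R_ML
    then show ?thesis using rand ml by (auto simp: MLrand_def[of \<psi>])
  next
    case R_wML
    then show ?thesis using rand wml by (auto simp: wMLrand_def[of \<psi>])
  next
    case R_C
    then show ?thesis using rand C by (auto simp: C_random_def[of \<psi>])
  next
    case R_S
    then show ?thesis using rand S by (auto simp: S_random_def[of \<psi>])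
  next
    case R_CH
    then show ?thesis using rand CH by (auto simp: CH_random_def)
  next
    case R_wCH
    then show ?thesis using rand CH by (auto simp: wCH_random_def)
  qed
qed

lemma obtain_half_power_less:
  assumes "(0 :: real) < e"
  obtains m where "(1/2) ^ m < e"
  using real_arch_pow_inv[OF assms, of "1/2"] by auto

theorem theorem2:
  fixes R :: rnotion and \<phi> :: "bool list \<Rightarrow> real set" and \<omega> :: "nat \<Rightarrow> bool"
  assumes "forecasting_system \<phi>"
    and "computable_fs \<phi>" and "precise \<phi>" and "temporal \<phi>"
    and "R_random R \<phi> \<omega>"
  shows "I_R R \<omega> = I_phi \<phi> \<omega>"
proof -
  note fs = \<open>forecasting_system \<phi>\<close>
  define p where "p n = flo \<phi> (replicate n False)" for n
  have flo: "flo \<phi> s = p (length s)" for s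
    using assms(4) unfolding p_def temporal_def flo_def by (metis length_replicate)
  have fhi: "fhi \<phi> s = p (length s)" for s
    using assms(3) flo by (simp add: precise_def)
  have \<phi>: "\<phi> s = {p (length s)}" for s
    using flo_le_fhi_bounds(4)[OF fs, of s] by (simp add: flo fhi)
  have p01: "0 \<le> p n" "p n \<le> 1" for n
    using flo_le_fhi_bounds[OF fs, of "replicate n False"] by (simp_all add: flo fhi)
  have comp: "computable_map sit_code (\<lambda>s. p (length s))"
    using assms(2) by (simp add: computable_fs_def flo[abs_def])

  define L U where "L = real_of_ereal (liminf (\<lambda>n. ereal (p n)))"
    and "U = real_of_ereal (limsup (\<lambda>n. ereal (p n)))"
  \<comment> \<open>Both limits lie in the unit interval, so \<open>real_of_ereal\<close> returns
    them and not its default value at infinity.\<close>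
  have "0 \<le> liminf (\<lambda>n. ereal (p n))" "limsup (\<lambda>n. ereal (p n)) \<le> 1"
    by (auto intro!: Liminf_bounded Limsup_bounded simp: p01)
  moreover have "liminf (\<lambda>n. ereal (p n)) \<le> limsup (\<lambda>n. ereal (p n))"
    by (rule Liminf_le_Limsup) simp
  ultimately have L: "liminf (\<lambda>n. ereal (p n)) = ereal L" and U: "limsup (\<lambda>n. ereal (p n)) = ereal U"
    and LU: "0 \<le> L" "L \<le> U" "U \<le> 1"
    unfolding L_def U_def
    by (cases "liminf (\<lambda>n. ereal (p n))"; cases "limsup (\<lambda>n. ereal (p n))"; simp)+
  have I_phi: "I_phi \<phi> \<omega> = {L..U}"
    by (simp add: I_phi_def flo fhi L_def U_def)

  \<comment> \<open>The two alternatives place the forecasts at the selected times below or above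
    the constant interval.\<close>
  have separated: False if "recursive_fun (\<lambda>k. of_bool (sel k))" "infinite {k. sel k}"
    "lo \<in> \<rat>" "hi \<in> \<rat>" "0 \<le> lo" "lo < hi" "hi \<le> 1" "0 \<le> a" "a \<le> b" "b \<le> 1"
    "R_random R (\<lambda>_. {a..b}) \<omega>"
    "(\<forall>k. sel k \<longrightarrow> p k \<le> lo) \<and> hi \<le> a \<or> b \<le> lo \<and> (\<forall>k. sel k \<longrightarrow> hi \<le> p k)" for sel lo hi a b
  proof -
    have fsI: "forecasting_system (\<lambda>_. {a..b})"
      using that by (auto simp: forecasting_system_def is_iforecast_def)
    have "fhi (\<lambda>_. {a..b}) s = b" "flo (\<lambda>_. {a..b}) s = a" for s
      using that by (simp_all add: fhi_def flo_def)
    then show False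
      using not_random_for_separated[OF fs fsI that(1-7) _ _ assms(5) that(11)]
        not_random_for_separated[OF fsI fs that(1-7) _ _ that(11) assms(5)] that(12)
      by (auto simp: flo fhi)
  qed

  have lower: "a \<le> L" if ab: "0 \<le> a" "a \<le> b" "b \<le> 1" and rand: "R_random R (\<lambda>_. {a..b}) \<omega>" for a b
  proof (rule ccontr)
    assume "\<not> a \<le> L"
    \<comment> \<open>The chain is \<open>L < L' < r < lo < hi < a\<close>. The accuracy
      \<open>m\<close> is chosen so that unselected times have forecasts below \<open>lo\<close> and
      selected ones above \<open>L'\<close>. Were there finitely many unselected times, the limit
      inferior would be at least \<open>L'\<close>; so the complement of \<open>sel\<close> is the
      set to bet on.\<close>
    then obtain L' where L': "L < L'" "L' < a" using dense by (metis not_le)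
    obtain r where r: "r \<in> \<rat>" "L' < r" "r < a" using Rats_dense_in_real L'(2) by blast
    obtain lo where lo: "lo \<in> \<rat>" "r < lo" "lo < a" using Rats_dense_in_real r(3) by blast
    obtain hi where hi: "hi \<in> \<rat>" "lo < hi" "hi < a" using Rats_dense_in_real lo(3) by blast
    obtain m where m: "(1/2) ^ m < min (lo - r) (r - L')"
      using obtain_half_power_less[of "min (lo - r) (r - L')"] lo(2) r(2) by auto
    have "0 \<le> r" using LU L' r by linarith
    then obtain sel where sel: "recursive_fun (\<lambda>k. of_bool (sel k))"
      "\<And>k. sel k \<Longrightarrow> r - (1/2) ^ m < p k" "\<And>k. \<not> sel k \<Longrightarrow> p k < r + (1/2) ^ m"
      using recursive_threshold[OF comp _ r(1)] by (metis length_replicate)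
    have "infinite {k. \<not> sel k}"
    proof
      assume fin: "finite {k. \<not> sel k}"
      have "\<forall>\<^sub>F n in sequentially. sel n"
        using fin unfolding cofinite_eq_sequentially[symmetric] eventually_cofinite .
      then have "\<forall>\<^sub>F n in sequentially. ereal L' \<le> ereal (p n)"
        by (rule eventually_mono) (use sel(2) m in force)
      then have "ereal L' \<le> liminf (\<lambda>n. ereal (p n))" by (rule Liminf_bounded)
      with L L'(1) show False by simp
    qed
    moreover have "p k \<le> lo" if "\<not> sel k" for k using sel(3)[OF that] m by simp
    ultimately show False
      using separated[OF recursive_fun_not[OF sel(1)] _ lo(1) hi(1) _ hi(2) _ ab rand]
        \<open>0 \<le> r\<close> lo(2) hi(3) ab by auto
  qed
  have upper: "U \<le> b" if ab: "0 \<le> a" "a \<le> b" "b \<le> 1" and rand: "R_random R (\<lambda>_. {a..b}) \<omega>" for a b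
  proof (rule ccontr)
    assume "\<not> U \<le> b"
    \<comment> \<open>The mirrored chain is \<open>b < lo < hi < r < U' < U\<close>. Selected times
      now have forecasts above \<open>hi\<close>, and there are infinitely many of them because
      otherwise the limit superior would be at most \<open>U'\<close>.\<close>
    then obtain U' where U': "b < U'" "U' < U" using dense by (metis not_le)
    obtain r where r: "r \<in> \<rat>" "b < r" "r < U'" using Rats_dense_in_real U'(1) by blast
    obtain hi where hi: "hi \<in> \<rat>" "b < hi" "hi < r" using Rats_dense_in_real r(2) by blast
    obtain lo where lo: "lo \<in> \<rat>" "b < lo" "lo < hi" using Rats_dense_in_real hi(2) by blast
    obtain m where m: "(1/2) ^ m < min (r - hi) (U' - r)"
      using obtain_half_power_less[of "min (r - hi) (U' - r)"] hi(3) r(3) by auto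
    have "0 \<le> r" using r ab by linarith
    then obtain sel where sel: "recursive_fun (\<lambda>k. of_bool (sel k))"
      "\<And>k. sel k \<Longrightarrow> r - (1/2) ^ m < p k" "\<And>k. \<not> sel k \<Longrightarrow> p k < r + (1/2) ^ m"
      using recursive_threshold[OF comp _ r(1)] by (metis length_replicate)
    have "infinite {k. sel k}"
    proof
      assume fin: "finite {k. sel k}"
      have "\<forall>\<^sub>F n in sequentially. \<not> sel n"
        using fin unfolding cofinite_eq_sequentially[symmetric] eventually_cofinite by simp
      then have "\<forall>\<^sub>F n in sequentially. ereal (p n) \<le> ereal U'"
        by (rule eventually_mono) (use sel(3) m in force)
      then have "limsup (\<lambda>n. ereal (p n)) \<le> ereal U'" by (rule Limsup_bounded)
      with U U'(2) show False by simp
    qed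
    moreover have "hi \<le> p k" if "sel k" for k using sel(2)[OF that] m by simp
    ultimately show False
      using separated[OF sel(1) _ lo(1) hi(1) _ lo(3) _ ab rand] ab lo(2) hi(3) r(3) U'(2) LU(3)
      by auto
  qed

  have "I_R R \<omega> \<subseteq> {L..U}"
  proof
    fix x assume x: "x \<in> I_R R \<omega>"
    have near: "L - e \<le> x \<and> x \<le> U + e" if "e > 0" for e
    proof -
      \<comment> \<open>The neighbourhood is clipped to the unit interval to be a legitimate
        forecast; all forecasts from some time on lie in it.\<close>
      let ?J = "{max 0 (L - e)..min 1 (U + e)}"
      have "ereal (L - e) < liminf (\<lambda>n. ereal (p n))" "limsup (\<lambda>n. ereal (p n)) < ereal (U + e)"
        unfolding L U using that by simp_all
      from less_LiminfD[OF this(1)] Limsup_lessD[OF this(2)]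
      have "\<forall>\<^sub>F n in sequentially. p n \<in> ?J"
        by eventually_elim (use p01 in auto)
      then obtain N where N: "\<And>n. n \<ge> N \<Longrightarrow> p n \<in> ?J" by (auto simp: eventually_sequentially)
      have J: "is_iforecast ?J"
        unfolding is_iforecast_def
        by (intro exI[of _ "max 0 (L - e)"] exI[of _ "min 1 (U + e)"]) (use LU that in auto)
      have "R_random R (\<lambda>_. ?J) \<omega>"
        by (rule random_eventually_wider[OF fs _ _ assms(5), of _ N])
          (use J N in \<open>auto simp: forecasting_system_def \<phi>\<close>)
      then have "x \<in> ?J" using x J unfolding I_R_def by blast
      then show ?thesis by auto
    qed
    have "L \<le> x" by (rule field_le_epsilon) (use near in force)
    moreover have "x \<le> U" by (rule field_le_epsilon) (use near in force)
    ultimately show "x \<in> {L..U}" by simp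
  qed
  moreover have "{L..U} \<subseteq> I_R R \<omega>"
  proof
    fix x assume x: "x \<in> {L..U}"
    have "x \<in> {a..b}" if "0 \<le> a" "a \<le> b" "b \<le> 1" "R_random R (\<lambda>_. {a..b}) \<omega>" for a b
      using lower[OF that] upper[OF that] x by auto
    then show "x \<in> I_R R \<omega>" unfolding I_R_def is_iforecast_def by blast
  qed
  ultimately show ?thesis unfolding I_phi by blast
qed

end
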